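(* Let $A$ be a finite-dimensional vector space over $\mathbf{k}$, let $B=\oplus_{i\in\mathbb{Z}}B_i$ be a $\mathbb{Z}$-graded vector space, let $\Delta_A:A\to A\otimes A$ and $\Delta_B:B\to B\,\widehat{\otimes}\,B$ be linear maps, and put $L:=A\otimes B$ with $L_i:=A\otimes B_i$. Define a linear map $\delta:L\to L\,\widehat{\otimes}\,L$ by $$\delta(a\otimes b)=(\mathrm{id}_{L\widehat{\otimes}L}-\widehat{\tau})\big(\Delta_A(a)\bullet\Delta_B(b)\big)\quad\text{for all } a\in A,\ b\in B,$$ where, writing $\Delta_A(a)=\sum_{(a)}a_{(1)}\otimes a_{(2)}$ and $\Delta_B(b)=\sum_{i,j,\alpha}b_{1i\alpha}\otimes b_{2j\alpha}$, $$\Delta_A(a)\bullet\Delta_B(b):=\sum_{(a)}\sum_{i,j,\alpha}(a_{(1)}\otimes b_{1i\alpha})\otimes(a_{(2)}\otimes b_{2j\alpha}).$$ (1) If $(A,\Delta_A)$ is a Novikov coalgebra and $(B,\Delta_B)$ is a completed right Novikov coalgebra, then $(L,\delta)$ is a completed Lie coalgebra. (2) If $B=\mathbf{k}[t,t^{-1}]$ with $\Delta_B(t^j)=\sum_{i\in\mathbb{Z}}(i+1)t^{-i-2}\otimes t^{j+i}$ for all $j\in\mathbb{Z}$ (which is a completed right Novikov coalgebra, graded by $B_i=\mathbf{k}t^{i+1}$), then $(L,\delta)$ is a completed Lie coalgebra if and only if $(A,\Delta_A)$ is a Novikov coalgebra.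
   Context: $\mathbf{k}$ is a field of characteristic zero. $\tau(x\otimes y)=y\otimes x$. A Novikov coalgebra is a vector space $A$ with a linear map $\Delta:A\to A\otimes A$ such that for all $a\in A$ $$(\mathrm{id}\otimes\Delta)\Delta(a)-(\tau\otimes\mathrm{id})(\mathrm{id}\otimes\Delta)\Delta(a)=(\Delta\otimes\mathrm{id})\Delta(a)-(\tau\otimes\mathrm{id})(\Delta\otimes\mathrm{id})\Delta(a),$$ $$(\tau\otimes\mathrm{id})(\mathrm{id}\otimes\Delta)\tau\Delta(a)=(\Delta\otimes\mathrm{id})\Delta(a).$$ Completed tensor products: for $\mathbb{Z}$-graded vector spaces $C=\oplus_iC_i$, $D=\oplus_jD_j$, put $C\,\widehat{\otimes}\,D:=\prod_{i,j\in\mathbb{Z}}C_i\otimes D_j$, and similarly for three factors. Elements are written as formal sums $\sum_{i,j,\alpha}c_{i\alpha}\otimes d_{j\alpha}$ with $c_{i\alpha}\in C_i$, $d_{j\alpha}\in D_j$ and, for each $(i,j)$, $\alpha$ in a finite index set. Maps are extended termwise: $(f\,\widehat{\otimes}\,g)(\sum c_{i\alpha}\otimes d_{j\alpha})=\sum f(c_{i\alpha})\otimes g(d_{j\alpha})$, $\widehat{\tau}(\sum c_{i\alpha}\otimes d_{j\alpha})=\sum d_{j\alpha}\otimes c_{i\alpha}$, and for $\Delta:C\to C\,\widehat{\otimes}\,C$, $\Delta(a)=\sum a_{1i\alpha}\otimes a_{2j\alpha}$, one sets $(\Delta\,\widehat{\otimes}\,\mathrm{id})\Delta(a)=\sum\Delta(a_{1i\alpha})\otimes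 a_{2j\alpha}\in C\,\widehat{\otimes}\,C\,\widehat{\otimes}\,C$, and similarly $(\mathrm{id}\,\widehat{\otimes}\,\Delta)\Delta(a)$. These composites are understood to be well defined (in each multidegree only finitely many terms contribute); this is part of the definitions below. A completed right Novikov coalgebra is a pair $(C,\Delta)$ with $C=\oplus_{i\in\mathbb{Z}}C_i$ a $\mathbb{Z}$-graded vector space and $\Delta:C\to C\,\widehat{\otimes}\,C$ linear such that for all $a\in C$ $$(\Delta\,\widehat{\otimes}\,\mathrm{id})\Delta(a)-(\mathrm{id}\,\widehat{\otimes}\,\widehat{\tau})(\Delta\,\widehat{\otimes}\,\mathrm{id})\Delta(a)=(\mathrm{id}\,\widehat{\otimes}\,\Delta)\Delta(a)-(\mathrm{id}\,\widehat{\otimes}\,\widehat{\tau})(\mathrm{id}\,\widehat{\otimes}\,\Delta)\Delta(a),$$ $$(\mathrm{id}\,\widehat{\otimes}\,\Delta)\Delta(a)=(\widehat{\tau}\,\widehat{\otimes}\,\mathrm{id})(\mathrm{id}\,\widehat{\otimes}\,\Delta)\Delta(a).$$ A completed Lie coalgebra is a pair $(L,\delta)$ with $L=\oplus_{i\in\mathbb{Z}}L_i$ a $\mathbb{Z}$-graded vector space and $\delta:L\to L\,\widehat{\otimes}\,L$ linear such that for all $a\in L$: $\delta(a)=-\widehat{\tau}\delta(a)$ and $(\mathrm{id}\,\widehat{\otimes}\,\delta)\delta(a)-(\widehat{\tau}\,\widehat{\otimes}\,\mathrm{id})(\mathrm{id}\,\widehat{\otimes}\,\delta)\delta(a)=(\delta\,\widehat{\otimes}\,\mathrm{id})\delta(a)$.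 *)

theory Defs
  imports Complex_Main "HOL-Library.Function_Algebras" "HOL-Library.Poly_Mapping"
begin

section \<open>Linear and multilinear maps on subspaces\<close>

text \<open>
  A vector space is given by a scalar multiplication \<open>s :: 'k \<Rightarrow> 'v \<Rightarrow> 'v\<close> on an ambient type
  together with a carrier \<open>V :: 'v set\<close>, a subspace. Maps only matter on the carrier.
\<close>

definition fscale :: "'k::field \<Rightarrow> ('x \<Rightarrow> 'k) \<Rightarrow> 'x \<Rightarrow> 'k" where
  "fscale c f = (\<lambda>x. c * f x)"

definition lin_on :: "('k::field \<Rightarrow> 'v::ab_group_add \<Rightarrow> 'v) \<Rightarrow> 'v set
    \<Rightarrow> ('k \<Rightarrow> 'u::ab_group_add \<Rightarrow> 'u) \<Rightarrow> ('v \<Rightarrow> 'u) \<Rightarrow> bool" where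
  "lin_on s V t f \<longleftrightarrow>
     (\<forall>x\<in>V. \<forall>y\<in>V. f (x + y) = f x + f y) \<and> (\<forall>c. \<forall>x\<in>V. f (s c x) = t c (f x))"

definition bilin_on :: "('k::field \<Rightarrow> 'v::ab_group_add \<Rightarrow> 'v) \<Rightarrow> 'v set
    \<Rightarrow> ('k \<Rightarrow> 'w::ab_group_add \<Rightarrow> 'w) \<Rightarrow> 'w set
    \<Rightarrow> ('k \<Rightarrow> 'u::ab_group_add \<Rightarrow> 'u) \<Rightarrow> ('v \<Rightarrow> 'w \<Rightarrow> 'u) \<Rightarrow> bool" where
  "bilin_on s V t W r f \<longleftrightarrow>
     (\<forall>y\<in>W. lin_on s V r (\<lambda>x. f x y)) \<and> (\<forall>x\<in>V. lin_on t W r (f x))"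

definition trilin_on :: "('k::field \<Rightarrow> 'v::ab_group_add \<Rightarrow> 'v) \<Rightarrow> 'v set
    \<Rightarrow> ('k \<Rightarrow> 'u::ab_group_add \<Rightarrow> 'u) \<Rightarrow> ('v \<Rightarrow> 'v \<Rightarrow> 'v \<Rightarrow> 'u) \<Rightarrow> bool" where
  "trilin_on s V r f \<longleftrightarrow>
     (\<forall>y\<in>V. \<forall>z\<in>V. lin_on s V r (\<lambda>x. f x y z)) \<and>
     (\<forall>x\<in>V. \<forall>z\<in>V. lin_on s V r (\<lambda>y. f x y z)) \<and>
     (\<forall>x\<in>V. \<forall>y\<in>V. lin_on s V r (\<lambda>z. f x y z))"


section \<open>Tensor products\<close>

text \<open>
  The pure tensor of \<open>v\<close> and \<open>w\<close> is realised as evaluation at \<open>(v, w)\<close> on the bilinear forms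
  on \<open>V \<times> W\<close>, and \<open>V \<otimes> W\<close> as the linear span of the pure tensors.  Over a field a linear
  combination of pairs is killed by all bilinear forms iff it lies in the span of the bilinearity
  relations, so this is the usual tensor product; the universal property is proved below
  (\<open>tensor_bilin\<close>, \<open>tensor_universal\<close>).  The value \<open>0\<close> on non-bilinear arguments is a dummy that
  makes equality of elements mean equality in the tensor product.

  Triple tensor products are realised in the same way on trilinear forms.

  For subspaces \<open>V'\<close> of \<open>V\<close> and \<open>W'\<close> of \<open>W\<close>, the product \<open>V' \<otimes> W'\<close> is identified with its
  image in \<open>V \<otimes> W\<close>.
\<close>

type_synonym ('k, 'v, 'w) tens = "('v \<Rightarrow> 'w \<Rightarrow> 'k) \<Rightarrow> 'k"
type_synonym ('k, 'v) tens3 = "('v \<Rightarrow> 'v \<Rightarrow> 'v \<Rightarrow> 'k) \<Rightarrow> 'k"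

definition tensor :: "('k::field \<Rightarrow> 'v::ab_group_add \<Rightarrow> 'v) \<Rightarrow> 'v set
    \<Rightarrow> ('k \<Rightarrow> 'w::ab_group_add \<Rightarrow> 'w) \<Rightarrow> 'w set \<Rightarrow> 'v \<Rightarrow> 'w \<Rightarrow> ('k, 'v, 'w) tens" where
  "tensor s V t W v w = (\<lambda>\<phi>. if bilin_on s V t W (*) \<phi> then \<phi> v w else 0)"

definition tensor_space :: "('k::field \<Rightarrow> 'v::ab_group_add \<Rightarrow> 'v) \<Rightarrow> 'v set
    \<Rightarrow> ('k \<Rightarrow> 'w::ab_group_add \<Rightarrow> 'w) \<Rightarrow> 'w set \<Rightarrow> 'v set \<Rightarrow> 'w set \<Rightarrow> ('k, 'v, 'w) tens set" where
  "tensor_space s V t W V' W' = module.span fscale {tensor s V t W v w | v w. v \<in> V' \<and> w \<in> W'}"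

definition tensor3 :: "('k::field \<Rightarrow> 'v::ab_group_add \<Rightarrow> 'v) \<Rightarrow> 'v set
    \<Rightarrow> 'v \<Rightarrow> 'v \<Rightarrow> 'v \<Rightarrow> ('k, 'v) tens3" where
  "tensor3 s V x y z = (\<lambda>\<phi>. if trilin_on s V (*) \<phi> then \<phi> x y z else 0)"

definition flip :: "('k, 'v, 'v) tens \<Rightarrow> ('k, 'v, 'v) tens" where
  "flip T = (\<lambda>\<phi>. T (\<lambda>x y. \<phi> y x))"

definition flip12 :: "('k, 'v) tens3 \<Rightarrow> ('k, 'v) tens3" where
  "flip12 T = (\<lambda>\<phi>. T (\<lambda>x y z. \<phi> y x z))"

definition flip23 :: "('k, 'v) tens3 \<Rightarrow> ('k, 'v) tens3" where
  "flip23 T = (\<lambda>\<phi>. T (\<lambda>x y z. \<phi> x z y))"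

text \<open>
  \<open>map_left s V f\<close> is \<open>f \<otimes> id\<close> and \<open>map_right s V f\<close> is \<open>id \<otimes> f\<close>, from \<open>V \<otimes> V\<close> to
  \<open>V \<otimes> V \<otimes> V\<close>, for a linear \<open>f\<close> from \<open>V\<close> to \<open>V \<otimes> V\<close>: see \<open>map_left_tensor\<close> and
  \<open>map_right_tensor\<close> below.
\<close>

definition map_left :: "('k::field \<Rightarrow> 'v::ab_group_add \<Rightarrow> 'v) \<Rightarrow> 'v set
    \<Rightarrow> ('v \<Rightarrow> ('k, 'v, 'v) tens) \<Rightarrow> ('k, 'v, 'v) tens \<Rightarrow> ('k, 'v) tens3" where
  "map_left s V f T =
     (\<lambda>\<phi>. if trilin_on s V (*) \<phi> then T (\<lambda>c d. f c (\<lambda>x y. \<phi> x y d)) else 0)"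

definition map_right :: "('k::field \<Rightarrow> 'v::ab_group_add \<Rightarrow> 'v) \<Rightarrow> 'v set
    \<Rightarrow> ('v \<Rightarrow> ('k, 'v, 'v) tens) \<Rightarrow> ('k, 'v, 'v) tens \<Rightarrow> ('k, 'v) tens3" where
  "map_right s V f T =
     (\<lambda>\<phi>. if trilin_on s V (*) \<phi> then T (\<lambda>c d. f d (\<lambda>x y. \<phi> c x y)) else 0)"


section \<open>Novikov coalgebras\<close>

definition comultiplication :: "('k::field \<Rightarrow> 'a::ab_group_add \<Rightarrow> 'a)
    \<Rightarrow> ('a \<Rightarrow> ('k, 'a, 'a) tens) \<Rightarrow> bool" where
  "comultiplication s \<Delta> \<longleftrightarrow>
     lin_on s UNIV fscale \<Delta> \<and> (\<forall>a. \<Delta> a \<in> tensor_space s UNIV s UNIV UNIV UNIV)"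

definition novikov_coalgebra :: "('k::field \<Rightarrow> 'a::ab_group_add \<Rightarrow> 'a)
    \<Rightarrow> ('a \<Rightarrow> ('k, 'a, 'a) tens) \<Rightarrow> bool" where
  "novikov_coalgebra s \<Delta> \<longleftrightarrow>
     vector_space s \<and> comultiplication s \<Delta> \<and>
     (\<forall>a.
        map_right s UNIV \<Delta> (\<Delta> a) - flip12 (map_right s UNIV \<Delta> (\<Delta> a)) =
        map_left s UNIV \<Delta> (\<Delta> a) - flip12 (map_left s UNIV \<Delta> (\<Delta> a)) \<and>
        flip12 (map_right s UNIV \<Delta> (flip (\<Delta> a))) = map_left s UNIV \<Delta> (\<Delta> a))"


section \<open>Graded spaces and completed tensor products\<close>

definition graded_space :: "('k::field \<Rightarrow> 'v::ab_group_add \<Rightarrow> 'v) \<Rightarrow> (int \<Rightarrow> 'v set) \<Rightarrow> bool" where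
  "graded_space s C \<longleftrightarrow>
     vector_space s \<and> (\<forall>i. module.subspace s (C i)) \<and>
     (\<forall>I x. finite I \<longrightarrow> (\<forall>i\<in>I. x i \<in> C i) \<longrightarrow> (\<Sum>i\<in>I. x i) = 0 \<longrightarrow> (\<forall>i\<in>I. x i = 0))"

text \<open>The carrier of the (internal) direct sum of the \<open>C i\<close>.\<close>

definition gspace :: "('k::field \<Rightarrow> 'v::ab_group_add \<Rightarrow> 'v) \<Rightarrow> (int \<Rightarrow> 'v set) \<Rightarrow> 'v set" where
  "gspace s C = module.span s (\<Union>i. C i)"

text \<open>An element of the completed tensor product is the family of its bihomogeneous components.\<close>

type_synonym ('k, 'v) ctens = "int \<Rightarrow> int \<Rightarrow> ('k, 'v, 'v) tens"
type_synonym ('k, 'v) ctens3 = "int \<Rightarrow> int \<Rightarrow> int \<Rightarrow> ('k, 'v) tens3"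

definition ctensor_space :: "('k::field \<Rightarrow> 'v::ab_group_add \<Rightarrow> 'v) \<Rightarrow> (int \<Rightarrow> 'v set)
    \<Rightarrow> ('k, 'v) ctens set" where
  "ctensor_space s C =
     {u. \<forall>i j. u i j \<in> tensor_space s (gspace s C) s (gspace s C) (C i) (C j)}"

definition cscale :: "'k::field \<Rightarrow> ('k, 'v) ctens \<Rightarrow> ('k, 'v) ctens" where
  "cscale c u = (\<lambda>i j. fscale c (u i j))"

definition cflip :: "('k, 'v) ctens \<Rightarrow> ('k, 'v) ctens" where
  "cflip u = (\<lambda>i j. flip (u j i))"

definition cflip12 :: "('k, 'v) ctens3 \<Rightarrow> ('k, 'v) ctens3" where
  "cflip12 w = (\<lambda>p q r. flip12 (w q p r))"

definition cflip23 :: "('k, 'v) ctens3 \<Rightarrow> ('k, 'v) ctens3" where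
  "cflip23 w = (\<lambda>p q r. flip23 (w p r q))"

definition completed_comultiplication :: "('k::field \<Rightarrow> 'v::ab_group_add \<Rightarrow> 'v)
    \<Rightarrow> (int \<Rightarrow> 'v set) \<Rightarrow> ('v \<Rightarrow> ('k, 'v) ctens) \<Rightarrow> bool" where
  "completed_comultiplication s C \<Delta> \<longleftrightarrow>
     lin_on s (gspace s C) cscale \<Delta> \<and> (\<forall>a\<in>gspace s C. \<Delta> a \<in> ctensor_space s C)"

text \<open>
  The component of \<open>(\<Delta> \<otimes> id) u\<close> in multidegree \<open>(p, q, r)\<close> collects, over all \<open>i\<close>, the image of
  \<open>u i r\<close> under the component of \<open>\<Delta> \<otimes> id\<close> from \<open>C i \<otimes> C r\<close> to \<open>C p \<otimes> C q \<otimes> C r\<close>; the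
  composite is well defined if only finitely many \<open>i\<close> contribute.  Similarly for \<open>id \<otimes> \<Delta>\<close>.
\<close>

definition cleft_term :: "('k::field \<Rightarrow> 'v::ab_group_add \<Rightarrow> 'v) \<Rightarrow> (int \<Rightarrow> 'v set)
    \<Rightarrow> ('v \<Rightarrow> ('k, 'v) ctens) \<Rightarrow> ('k, 'v) ctens \<Rightarrow> int \<Rightarrow> int \<Rightarrow> int \<Rightarrow> int \<Rightarrow> ('k, 'v) tens3" where
  "cleft_term s C \<Delta> u p q r i = map_left s (gspace s C) (\<lambda>c. \<Delta> c p q) (u i r)"

definition cright_term :: "('k::field \<Rightarrow> 'v::ab_group_add \<Rightarrow> 'v) \<Rightarrow> (int \<Rightarrow> 'v set)
    \<Rightarrow> ('v \<Rightarrow> ('k, 'v) ctens) \<Rightarrow> ('k, 'v) ctens \<Rightarrow> int \<Rightarrow> int \<Rightarrow> int \<Rightarrow> int \<Rightarrow> ('k, 'v) tens3" where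
  "cright_term s C \<Delta> u p q r j = map_right s (gspace s C) (\<lambda>c. \<Delta> c q r) (u p j)"

definition cleft_defined :: "('k::field \<Rightarrow> 'v::ab_group_add \<Rightarrow> 'v) \<Rightarrow> (int \<Rightarrow> 'v set)
    \<Rightarrow> ('v \<Rightarrow> ('k, 'v) ctens) \<Rightarrow> ('k, 'v) ctens \<Rightarrow> bool" where
  "cleft_defined s C \<Delta> u \<longleftrightarrow> (\<forall>p q r. finite {i. cleft_term s C \<Delta> u p q r i \<noteq> 0})"

definition cright_defined :: "('k::field \<Rightarrow> 'v::ab_group_add \<Rightarrow> 'v) \<Rightarrow> (int \<Rightarrow> 'v set)
    \<Rightarrow> ('v \<Rightarrow> ('k, 'v) ctens) \<Rightarrow> ('k, 'v) ctens \<Rightarrow> bool" where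
  "cright_defined s C \<Delta> u \<longleftrightarrow> (\<forall>p q r. finite {j. cright_term s C \<Delta> u p q r j \<noteq> 0})"

definition cleft :: "('k::field \<Rightarrow> 'v::ab_group_add \<Rightarrow> 'v) \<Rightarrow> (int \<Rightarrow> 'v set)
    \<Rightarrow> ('v \<Rightarrow> ('k, 'v) ctens) \<Rightarrow> ('k, 'v) ctens \<Rightarrow> ('k, 'v) ctens3" where
  "cleft s C \<Delta> u =
     (\<lambda>p q r. \<Sum>i | cleft_term s C \<Delta> u p q r i \<noteq> 0. cleft_term s C \<Delta> u p q r i)"

definition cright :: "('k::field \<Rightarrow> 'v::ab_group_add \<Rightarrow> 'v) \<Rightarrow> (int \<Rightarrow> 'v set)
    \<Rightarrow> ('v \<Rightarrow> ('k, 'v) ctens) \<Rightarrow> ('k, 'v) ctens \<Rightarrow> ('k, 'v) ctens3" where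
  "cright s C \<Delta> u =
     (\<lambda>p q r. \<Sum>j | cright_term s C \<Delta> u p q r j \<noteq> 0. cright_term s C \<Delta> u p q r j)"

definition completed_right_novikov_coalgebra :: "('k::field \<Rightarrow> 'v::ab_group_add \<Rightarrow> 'v)
    \<Rightarrow> (int \<Rightarrow> 'v set) \<Rightarrow> ('v \<Rightarrow> ('k, 'v) ctens) \<Rightarrow> bool" where
  "completed_right_novikov_coalgebra s C \<Delta> \<longleftrightarrow>
     graded_space s C \<and> completed_comultiplication s C \<Delta> \<and>
     (\<forall>a\<in>gspace s C.
        cleft_defined s C \<Delta> (\<Delta> a) \<and> cright_defined s C \<Delta> (\<Delta> a) \<and>
        cleft s C \<Delta> (\<Delta> a) - cflip23 (cleft s C \<Delta> (\<Delta> a)) =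
        cright s C \<Delta> (\<Delta> a) - cflip23 (cright s C \<Delta> (\<Delta> a)) \<and>
        cright s C \<Delta> (\<Delta> a) = cflip12 (cright s C \<Delta> (\<Delta> a)))"

definition completed_lie_coalgebra :: "('k::field \<Rightarrow> 'v::ab_group_add \<Rightarrow> 'v)
    \<Rightarrow> (int \<Rightarrow> 'v set) \<Rightarrow> ('v \<Rightarrow> ('k, 'v) ctens) \<Rightarrow> bool" where
  "completed_lie_coalgebra s C \<delta> \<longleftrightarrow>
     graded_space s C \<and> completed_comultiplication s C \<delta> \<and>
     (\<forall>a\<in>gspace s C.
        cleft_defined s C \<delta> (\<delta> a) \<and> cright_defined s C \<delta> (\<delta> a) \<and>
        \<delta> a = - cflip (\<delta> a) \<and>
        cright s C \<delta> (\<delta> a) - cflip12 (cright s C \<delta> (\<delta> a)) = cleft s C \<delta> (\<delta> a))"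


section \<open>The induced cobracket\<close>

text \<open>The grading of \<open>A \<otimes> B\<close>, with \<open>A\<close> the whole type \<open>'a\<close>; its total space is \<open>A \<otimes> B\<close>
  by \<open>gspace_tensor_grading\<close> below.\<close>

definition tensor_grading :: "('k::field \<Rightarrow> 'a::ab_group_add \<Rightarrow> 'a)
    \<Rightarrow> ('k \<Rightarrow> 'b::ab_group_add \<Rightarrow> 'b) \<Rightarrow> (int \<Rightarrow> 'b set) \<Rightarrow> int \<Rightarrow> ('k, 'a, 'b) tens set" where
  "tensor_grading sA sB B i = tensor_space sA UNIV sB (gspace sB B) UNIV (B i)"

text \<open>The bilinear extension of
  \<open>(a1 \<otimes> a2) \<bullet> (b1 \<otimes> b2) = (a1 \<otimes> b1) \<otimes> (a2 \<otimes> b2)\<close>; see \<open>bullet_tensor\<close> below.\<close>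

definition bullet :: "('k::field \<Rightarrow> 'a::ab_group_add \<Rightarrow> 'a)
    \<Rightarrow> ('k \<Rightarrow> 'b::ab_group_add \<Rightarrow> 'b) \<Rightarrow> (int \<Rightarrow> 'b set)
    \<Rightarrow> ('k, 'a, 'a) tens \<Rightarrow> ('k, 'b, 'b) tens
    \<Rightarrow> ('k, ('k, 'a, 'b) tens, ('k, 'a, 'b) tens) tens" where
  "bullet sA sB B S T =
     (\<lambda>\<phi>. let L = gspace fscale (tensor_grading sA sB B);
              ten = tensor sA UNIV sB (gspace sB B)
          in if bilin_on fscale L fscale L (*) \<phi>
             then S (\<lambda>a1 a2. T (\<lambda>b1 b2. \<phi> (ten a1 b1) (ten a2 b2))) else 0)"

definition cbullet :: "('k::field \<Rightarrow> 'a::ab_group_add \<Rightarrow> 'a)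
    \<Rightarrow> ('k \<Rightarrow> 'b::ab_group_add \<Rightarrow> 'b) \<Rightarrow> (int \<Rightarrow> 'b set)
    \<Rightarrow> ('k, 'a, 'a) tens \<Rightarrow> ('k, 'b) ctens \<Rightarrow> ('k, ('k, 'a, 'b) tens) ctens" where
  "cbullet sA sB B S u = (\<lambda>i j. bullet sA sB B S (u i j))"

text \<open>These conditions determine \<open>\<delta>\<close> on \<open>A \<otimes> B\<close>, and such a \<open>\<delta>\<close> exists
  (\<open>ex_induced_cobracket\<close> below).\<close>

definition induced_cobracket :: "('k::field \<Rightarrow> 'a::ab_group_add \<Rightarrow> 'a)
    \<Rightarrow> ('a \<Rightarrow> ('k, 'a, 'a) tens)
    \<Rightarrow> ('k \<Rightarrow> 'b::ab_group_add \<Rightarrow> 'b) \<Rightarrow> (int \<Rightarrow> 'b set) \<Rightarrow> ('b \<Rightarrow> ('k, 'b) ctens)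
    \<Rightarrow> (('k, 'a, 'b) tens \<Rightarrow> ('k, ('k, 'a, 'b) tens) ctens) \<Rightarrow> bool" where
  "induced_cobracket sA \<Delta>A sB B \<Delta>B \<delta> \<longleftrightarrow>
     lin_on fscale (gspace fscale (tensor_grading sA sB B)) cscale \<delta> \<and>
     (\<forall>a. \<forall>b\<in>gspace sB B.
        \<delta> (tensor sA UNIV sB (gspace sB B) a b) =
        cbullet sA sB B (\<Delta>A a) (\<Delta>B b) - cflip (cbullet sA sB B (\<Delta>A a) (\<Delta>B b)))"


section \<open>Laurent polynomials\<close>

definition lscale :: "'k::field \<Rightarrow> (int \<Rightarrow>\<^sub>0 'k) \<Rightarrow> (int \<Rightarrow>\<^sub>0 'k)" where
  "lscale c = Poly_Mapping.map ((*) c)"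

definition tpow :: "int \<Rightarrow> (int \<Rightarrow>\<^sub>0 'k::field)" where
  "tpow n = Poly_Mapping.single n 1"

definition laurent_grading :: "int \<Rightarrow> (int \<Rightarrow>\<^sub>0 'k::field) set" where
  "laurent_grading i = {lscale c (tpow (i + 1)) | c. True}"

text \<open>
  The bidegree \<open>(p, q)\<close> component of the formal sum of all \<open>(i + 1) t\<^sup>-\<^sup>i\<^sup>-\<^sup>2 \<otimes> t\<^sup>j\<^sup>+\<^sup>i\<close>; as
  \<open>t\<^sup>n\<close> has degree \<open>n - 1\<close>, at most one \<open>i\<close> contributes.
\<close>

definition laurent_comult_tpow :: "int \<Rightarrow> ('k::field, int \<Rightarrow>\<^sub>0 'k) ctens" where
  "laurent_comult_tpow j = (\<lambda>p q.
     \<Sum>i | - i - 2 = p + 1 \<and> j + i = q + 1.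
       fscale (of_int (i + 1))
         (tensor lscale (gspace lscale laurent_grading) lscale (gspace lscale laurent_grading)
            (tpow (- i - 2)) (tpow (j + i))))"

definition laurent_comult :: "(int \<Rightarrow>\<^sub>0 'k::field) \<Rightarrow> ('k, int \<Rightarrow>\<^sub>0 'k) ctens" where
  "laurent_comult f =
     (\<Sum>j\<in>Poly_Mapping.keys f. cscale (Poly_Mapping.lookup f j) (laurent_comult_tpow j))"


section \<open>Basic facts\<close>

lemma vector_space_fscale: "vector_space (fscale :: 'k::field \<Rightarrow> ('x \<Rightarrow> 'k) \<Rightarrow> _)"
  by unfold_locales (auto simp: fscale_def fun_eq_iff algebra_simps)

interpretation fs: vector_space "fscale :: 'k::field \<Rightarrow> ('x \<Rightarrow> 'k) \<Rightarrow> _"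
  by (rule vector_space_fscale)

lemma vector_space_mult: "vector_space ((*) :: 'k::field \<Rightarrow> 'k \<Rightarrow> 'k)"
  by unfold_locales (auto simp: algebra_simps)

lemma lookup_lscale [simp]: "Poly_Mapping.lookup (lscale c f) n = c * Poly_Mapping.lookup f n"
  by (simp add: lscale_def map.rep_eq when_def)

lemma vector_space_lscale: "vector_space (lscale :: 'k::field \<Rightarrow> _)"
  by unfold_locales (auto simp: poly_mapping_eq_iff fun_eq_iff lookup_add algebra_simps)

lemma gspace_laurent: "gspace lscale laurent_grading = (UNIV :: (int \<Rightarrow>\<^sub>0 'k::field) set)"
proof -
  interpret vector_space "lscale :: 'k \<Rightarrow> _" by (rule vector_space_lscale)
  have "f \<in> span (\<Union>i. laurent_grading i)" for f :: "int \<Rightarrow>\<^sub>0 'k"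
  proof -
    have "f = (\<Sum>n\<in>Poly_Mapping.keys f. lscale (Poly_Mapping.lookup f n) (tpow (n - 1 + 1)))"
      by (simp add: poly_mapping_eq_iff fun_eq_iff lookup_sum tpow_def lookup_single when_def
          in_keys_iff if_distrib[of "\<lambda>z. _ * z"] cong: if_cong)
    moreover have "lscale c (tpow (n - 1 + 1)) \<in> span (\<Union>i. laurent_grading i)" for c n
      by (rule span_base, rule UN_I[of "n - 1"]) (auto simp: laurent_grading_def)
    ultimately show ?thesis by (metis (no_types, lifting) span_sum)
  qed
  then show ?thesis by (auto simp: gspace_def)
qed

lemma sum_fun_apply: "(\<Sum>i\<in>I. f i) x = (\<Sum>i\<in>I. f i x)"
  for f :: "'i \<Rightarrow> 'x \<Rightarrow> 'y::comm_monoid_add"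
  by (induction I rule: infinite_finite_induct) auto

lemma laurent_comult_tpow_eq: "laurent_comult (tpow j) = laurent_comult_tpow j"
  by (simp add: laurent_comult_def tpow_def cscale_def fscale_def)

lemma tensor_bilin:
  assumes "vector_space s" "module.subspace s V" "vector_space t" "module.subspace t W"
  shows "bilin_on s V t W fscale (tensor s V t W)"
  using assms
  by (auto simp: bilin_on_def lin_on_def tensor_def fscale_def fun_eq_iff)

lemma tensor_spaceI:
  "v \<in> V' \<Longrightarrow> w \<in> W' \<Longrightarrow> tensor s V t W v w \<in> tensor_space s V t W V' W'"
  unfolding tensor_space_def by (rule fs.span_base) auto

lemma separating_form:
  fixes r :: "'k::field \<Rightarrow> 'u::ab_group_add \<Rightarrow> 'u"
  assumes "vector_space r" "u \<noteq> 0"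
  obtains h where "lin_on r UNIV (*) h" "h u \<noteq> 0"
proof -
  interpret vector_space_pair r "(*) :: 'k \<Rightarrow> 'k \<Rightarrow> 'k"
    by (intro vector_space_pair.intro assms vector_space_mult)
  have "vs1.independent {u}" using assms(2) by simp
  from linear_independent_extend[OF this, of "\<lambda>_. 1"]
  obtain h where "Vector_Spaces.linear r (*) h" "h u = 1" by auto
  then show thesis
    by (intro that[of h])
      (auto simp: lin_on_def Vector_Spaces.linear_iff)
qed

text \<open>Uniqueness of the linear \<open>g\<close> is immediate, as the pure tensors span.\<close>

lemma tensor_universal:
  fixes r :: "'k::field \<Rightarrow> 'u::ab_group_add \<Rightarrow> 'u"
  assumes r: "vector_space r" and f: "bilin_on s V t W r f"
  shows "\<exists>g. lin_on fscale (tensor_space s V t W V W) r g \<and>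
             (\<forall>v\<in>V. \<forall>w\<in>W. g (tensor s V t W v w) = f v w)"
proof -
  interpret r: vector_space r by (rule r)
  let ?H = "\<lambda>h. lin_on r UNIV (*) (h :: 'u \<Rightarrow> 'k)"
  let ?P = "\<lambda>T u. \<forall>h. ?H h \<longrightarrow> h u = T (\<lambda>v w. h (f v w))"
  have Hdiff: "h (x - y) = h x - h y" if "?H h" for h x y
  proof -
    have "h (x - y + y) = h (x - y) + h y" using that unfolding lin_on_def by blast
    then show ?thesis by simp
  qed
  have uniq: "u = u'" if "?P T u" "?P T u'" for T u u'
  proof (rule ccontr)
    assume "u \<noteq> u'"
    then have "u - u' \<noteq> 0" by simp
    with r obtain h where h: "?H h" "h (u - u') \<noteq> 0" by (rule separating_form)
    then show False using that Hdiff[OF h(1)] by auto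
  qed
  have pure: "?P (tensor s V t W v w) (f v w)" if "v \<in> V" "w \<in> W" for v w
    using f that by (auto simp: tensor_def bilin_on_def lin_on_def)
  have add: "?P (S + T) (u + u')" if "?P S u" "?P T u'" for S T u u'
    using that by (auto simp: lin_on_def)
  have scl: "?P (fscale c T) (r c u)" if "?P T u" for c T u
    using that by (auto simp: lin_on_def fscale_def)
  have H0: "h 0 = 0" if "?H h" for h using Hdiff[OF that, of 0 0] by simp
  have ex: "\<exists>u. ?P T u" if "T \<in> tensor_space s V t W V W" for T
    using that unfolding tensor_space_def
  proof (induction rule: fs.span_induct_alt)
    case base
    show ?case by (rule exI[of _ 0]) (use H0 in auto)
  next
    case (step c x y)
    then obtain v w where x: "x = tensor s V t W v w" "v \<in> V" "w \<in> W" by auto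
    from step obtain u where "?P y u" by blast
    from add[OF scl[OF pure[OF x(2,3)], of c] this]
    show ?case unfolding x(1) by (rule exI)
  qed
  define g where "g T = (THE u. ?P T u)" for T
  have g: "g T = u" if "?P T u" for T u
    unfolding g_def by (rule the_equality, rule that, rule uniq[OF _ that])
  have Pg: "?P T (g T)" if "T \<in> tensor_space s V t W V W" for T
    using ex[OF that] by (elim exE) (simp only: g)
  have "lin_on fscale (tensor_space s V t W V W) r g"
    unfolding lin_on_def by (intro conjI ballI allI g add scl Pg)
  moreover have "\<forall>v\<in>V. \<forall>w\<in>W. g (tensor s V t W v w) = f v w"
    by (intro ballI g pure)
  ultimately show ?thesis by blast
qed

lemma flip_tensor: "flip (tensor s V t W v w) = tensor t W s V w v"
proof -
  have "bilin_on s V t W (*) (\<lambda>x y. \<phi> y x) \<longleftrightarrow> bilin_on t W s V (*) \<phi>" for \<phi>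
    by (auto simp: bilin_on_def)
  then show ?thesis by (simp add: flip_def tensor_def fun_eq_iff)
qed

text \<open>Elements of a tensor product act linearly on bilinear forms, and only see their values
  on the carriers.\<close>

lemma tensor_space_linear:
  assumes "T \<in> tensor_space s V t W V W"
    and "bilin_on s V t W (*) \<phi>" "bilin_on s V t W (*) \<psi>" "bilin_on s V t W (*) \<chi>"
    and "\<And>v w. v \<in> V \<Longrightarrow> w \<in> W \<Longrightarrow> \<chi> v w = c * \<phi> v w + \<psi> v w"
  shows "T \<chi> = c * T \<phi> + T \<psi>"
  using assms(1) unfolding tensor_space_def
proof (induction rule: fs.span_induct_alt)
  case base
  show ?case by simp
next
  case (step d x y)
  then obtain v w where x: "x = tensor s V t W v w" "v \<in> V" "w \<in> W" by auto
  then have "x \<chi> = c * x \<phi> + x \<psi>" using assms by (auto simp: tensor_def)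
  with step show ?case by (simp add: fscale_def algebra_simps)
qed

lemma tensor_space_add:
  assumes "T \<in> tensor_space s V t W V W"
    and "bilin_on s V t W (*) \<phi>" "bilin_on s V t W (*) \<psi>" "bilin_on s V t W (*) \<chi>"
    and "\<And>v w. v \<in> V \<Longrightarrow> w \<in> W \<Longrightarrow> \<chi> v w = \<phi> v w + \<psi> v w"
  shows "T \<chi> = T \<phi> + T \<psi>"
  using tensor_space_linear[OF assms(1-4), of 1] assms(5) by simp

lemma tensor_space_scale:
  assumes "T \<in> tensor_space s V t W V W"
    and "bilin_on s V t W (*) \<phi>" "bilin_on s V t W (*) \<chi>"
    and "\<And>v w. v \<in> V \<Longrightarrow> w \<in> W \<Longrightarrow> \<chi> v w = c * \<phi> v w"
  shows "T \<chi> = c * T \<phi>"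
proof -
  have z: "bilin_on s V t W (*) (\<lambda>_ _. 0)" by (simp add: bilin_on_def lin_on_def)
  have "T (\<lambda>_ _. 0) = 0" using tensor_space_linear[OF assms(1) z z z, of "- 1"] by simp
  then show ?thesis using tensor_space_linear[OF assms(1,2) z assms(3), of c] assms(4) by simp
qed

lemma tensor_space_mono:
  "V' \<subseteq> V'' \<Longrightarrow> W' \<subseteq> W'' \<Longrightarrow> tensor_space s V t W V' W' \<subseteq> tensor_space s V t W V'' W''"
  unfolding tensor_space_def by (rule fs.span_mono) blast

lemma map_left_tensor:
  assumes "lin_on s V fscale f" and f: "\<And>c. c \<in> V \<Longrightarrow> f c \<in> tensor_space s V s V V V"
    and cd: "c \<in> V" "d \<in> V"
    and fc: "f c = (\<Sum>i\<in>I. tensor s V s V (x i) (y i))"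
    and xy: "\<And>i. i \<in> I \<Longrightarrow> x i \<in> V" "\<And>i. i \<in> I \<Longrightarrow> y i \<in> V"
    and V: "vector_space s" "module.subspace s V"
  shows "map_left s V f (tensor s V s V c d) = (\<Sum>i\<in>I. tensor3 s V (x i) (y i) d)"
proof (rule ext)
  fix \<phi> :: "'b \<Rightarrow> 'b \<Rightarrow> 'b \<Rightarrow> 'a"
  interpret vector_space s by fact
  note sub = subspace_add[OF V(2)] subspace_scale[OF V(2)]
  show "map_left s V f (tensor s V s V c d) \<phi> = (\<Sum>i\<in>I. tensor3 s V (x i) (y i) d) \<phi>"
  proof (cases "trilin_on s V (*) \<phi>")
    case True
    have b: "bilin_on s V s V (*) (\<lambda>x y. \<phi> x y e)" if "e \<in> V" for e
      using True that by (auto simp: bilin_on_def trilin_on_def)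
    have "bilin_on s V s V (*) (\<lambda>c d. f c (\<lambda>x y. \<phi> x y d))"
      unfolding bilin_on_def
    proof (intro conjI ballI)
      fix d assume "d \<in> V"
      show "lin_on s V (*) (\<lambda>c. f c (\<lambda>x y. \<phi> x y d))"
        using assms(1) by (auto simp: lin_on_def fscale_def)
    next
      fix c assume c: "c \<in> V"
      show "lin_on s V (*) (\<lambda>d. f c (\<lambda>x y. \<phi> x y d))"
        unfolding lin_on_def
        using True sub
        by (auto intro!: tensor_space_add[OF f[OF c]] tensor_space_scale[OF f[OF c]] b
            simp: trilin_on_def lin_on_def)
    qed
    then have "map_left s V f (tensor s V s V c d) \<phi> = f c (\<lambda>x y. \<phi> x y d)"
      using True by (simp add: map_left_def tensor_def)
    also have "\<dots> = (\<Sum>i\<in>I. \<phi> (x i) (y i) d)"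
      by (simp add: fc sum_fun_apply tensor_def b cd)
    finally show ?thesis using True by (simp add: sum_fun_apply tensor3_def)
  qed (simp add: map_left_def sum_fun_apply tensor3_def)
qed

lemma map_right_tensor:
  assumes "lin_on s V fscale f" and f: "\<And>c. c \<in> V \<Longrightarrow> f c \<in> tensor_space s V s V V V"
    and cd: "c \<in> V" "d \<in> V"
    and fd: "f d = (\<Sum>i\<in>I. tensor s V s V (x i) (y i))"
    and xy: "\<And>i. i \<in> I \<Longrightarrow> x i \<in> V" "\<And>i. i \<in> I \<Longrightarrow> y i \<in> V"
    and V: "vector_space s" "module.subspace s V"
  shows "map_right s V f (tensor s V s V c d) = (\<Sum>i\<in>I. tensor3 s V c (x i) (y i))"
proof (rule ext)
  fix \<phi> :: "'b \<Rightarrow> 'b \<Rightarrow> 'b \<Rightarrow> 'a"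
  interpret vector_space s by fact
  note sub = subspace_add[OF V(2)] subspace_scale[OF V(2)]
  show "map_right s V f (tensor s V s V c d) \<phi> = (\<Sum>i\<in>I. tensor3 s V c (x i) (y i)) \<phi>"
  proof (cases "trilin_on s V (*) \<phi>")
    case True
    have b: "bilin_on s V s V (*) (\<lambda>x y. \<phi> e x y)" if "e \<in> V" for e
      using True that by (auto simp: bilin_on_def trilin_on_def)
    have "bilin_on s V s V (*) (\<lambda>c d. f d (\<lambda>x y. \<phi> c x y))"
      unfolding bilin_on_def
    proof (intro conjI ballI)
      fix c assume "c \<in> V"
      show "lin_on s V (*) (\<lambda>d. f d (\<lambda>x y. \<phi> c x y))"
        using assms(1) by (auto simp: lin_on_def fscale_def)
    next
      fix d assume d: "d \<in> V"
      show "lin_on s V (*) (\<lambda>c. f d (\<lambda>x y. \<phi> c x y))"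
        unfolding lin_on_def
        using True sub
        by (auto intro!: tensor_space_add[OF f[OF d]] tensor_space_scale[OF f[OF d]] b
            simp: trilin_on_def lin_on_def)
    qed
    then have "map_right s V f (tensor s V s V c d) \<phi> = f d (\<lambda>x y. \<phi> c x y)"
      using True by (simp add: map_right_def tensor_def)
    also have "\<dots> = (\<Sum>i\<in>I. \<phi> c (x i) (y i))"
      by (simp add: fd sum_fun_apply tensor_def b cd)
    finally show ?thesis using True by (simp add: sum_fun_apply tensor3_def)
  qed (simp add: map_right_def sum_fun_apply tensor3_def)
qed

context
  fixes sA :: "'k::field \<Rightarrow> 'a::ab_group_add \<Rightarrow> 'a"
    and sB :: "'k \<Rightarrow> 'b::ab_group_add \<Rightarrow> 'b" and B :: "int \<Rightarrow> 'b set"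
  assumes sA: "vector_space sA" and gB: "graded_space sB B"
begin

interpretation A: vector_space sA by (rule sA)
interpretation B: vector_space sB using gB by (simp add: graded_space_def)

private abbreviation "G \<equiv> gspace sB B"
private abbreviation "ten \<equiv> tensor sA UNIV sB G"
private abbreviation "L \<equiv> gspace fscale (tensor_grading sA sB B)"

private lemma G_sub: "B.subspace G"
  by (simp add: gspace_def)

private lemma B_sub_G: "B i \<subseteq> G"
  unfolding gspace_def by (auto intro: B.span_base)

private lemma ten_bilin: "bilin_on sA UNIV sB G fscale ten"
  by (rule tensor_bilin[OF sA A.subspace_UNIV B.vector_space_axioms G_sub])

lemma gspace_tensor_grading: "L = tensor_space sA UNIV sB G UNIV G"
proof
  have "tensor_grading sA sB B i \<subseteq> tensor_space sA UNIV sB G UNIV G" for i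
    unfolding tensor_grading_def by (rule tensor_space_mono) (use B_sub_G in auto)
  then show "L \<subseteq> tensor_space sA UNIV sB G UNIV G"
    unfolding gspace_def[of fscale]
    by (intro fs.span_minimal) (auto simp: tensor_space_def)
next
  have "ten a b \<in> L" if "b \<in> G" for a b
  proof -
    from that have "b \<in> B.span (\<Union>i. B i)" by (simp only: gspace_def)
    then have "b \<in> G \<and> ten a b \<in> L"
    proof (induction rule: B.span_induct_alt)
      case base
      have "ten a (sB 0 0) = fscale 0 (ten a 0)"
        using ten_bilin B.subspace_0[OF G_sub] unfolding bilin_on_def lin_on_def by blast
      then have "ten a 0 = 0" by (simp only: B.scale_zero_left fs.scale_zero_left)
      moreover have "0 \<in> L" unfolding gspace_def[of fscale] by (rule fs.span_zero)
      ultimately show ?case using B.subspace_0[OF G_sub] by (simp only: simp_thms)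
    next
      case (step c x y)
      then obtain i where x: "x \<in> B i" by blast
      then have xG: "x \<in> G" using B_sub_G by blast
      have yG: "y \<in> G" using step by blast
      have "ten a x \<in> tensor_grading sA sB B i"
        unfolding tensor_grading_def by (rule tensor_spaceI) (use x in auto)
      then have "ten a x \<in> L" unfolding gspace_def[of fscale] by (blast intro: fs.span_base)
      moreover have "ten a (sB c x + y) = fscale c (ten a x) + ten a y"
        using ten_bilin xG yG B.subspace_scale[OF G_sub xG, of c]
        unfolding bilin_on_def lin_on_def by auto
      moreover have "ten a y \<in> L" using step by blast
      ultimately have "ten a (sB c x + y) \<in> L"
        by (simp only: gspace_def[of fscale] fs.span_add fs.span_scale)
      moreover have "sB c x + y \<in> G"
        using xG yG B.subspace_scale[OF G_sub] B.subspace_add[OF G_sub] by blast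
      ultimately show ?case by blast
    qed
    then show ?thesis by blast
  qed
  moreover have "fs.subspace L" by (simp add: gspace_def[of fscale])
  ultimately show "tensor_space sA UNIV sB G UNIV G \<subseteq> L"
    unfolding tensor_space_def by (intro fs.span_minimal) blast
qed

private lemma ten_L: "b \<in> G \<Longrightarrow> ten a b \<in> L"
  unfolding gspace_tensor_grading by (rule tensor_spaceI) auto

private lemma ten_simps:
  "b \<in> G \<Longrightarrow> ten (a + a') b = ten a b + ten a' b"
  "b \<in> G \<Longrightarrow> ten (sA c a) b = fscale c (ten a b)"
  "b \<in> G \<Longrightarrow> b' \<in> G \<Longrightarrow> ten a (b + b') = ten a b + ten a b'"
  "b \<in> G \<Longrightarrow> ten a (sB c b) = fscale c (ten a b)"
  using ten_bilin unfolding bilin_on_def lin_on_def by blast+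

private lemma form_simps:
  assumes "bilin_on fscale L fscale L (*) \<phi>"
  shows "x \<in> L \<Longrightarrow> y \<in> L \<Longrightarrow> z \<in> L \<Longrightarrow> \<phi> (x + y) z = \<phi> x z + \<phi> y z"
    "x \<in> L \<Longrightarrow> z \<in> L \<Longrightarrow> \<phi> (fscale c x) z = c * \<phi> x z"
    "x \<in> L \<Longrightarrow> y \<in> L \<Longrightarrow> z \<in> L \<Longrightarrow> \<phi> z (x + y) = \<phi> z x + \<phi> z y"
    "x \<in> L \<Longrightarrow> z \<in> L \<Longrightarrow> \<phi> z (fscale c x) = c * \<phi> z x"
  using assms unfolding bilin_on_def lin_on_def by blast+

private lemma form_B:
  assumes "bilin_on fscale L fscale L (*) \<phi>"
  shows "bilin_on sB G sB G (*) (\<lambda>b1 b2. \<phi> (ten a1 b1) (ten a2 b2))"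
  unfolding bilin_on_def lin_on_def
  by (simp add: ten_simps ten_L form_simps[OF assms])

private lemma form_A:
  assumes "bilin_on fscale L fscale L (*) \<phi>" "b1 \<in> G" "b2 \<in> G"
  shows "bilin_on sA UNIV sA UNIV (*) (\<lambda>a1 a2. \<phi> (ten a1 b1) (ten a2 b2))"
  unfolding bilin_on_def lin_on_def
  by (simp add: ten_simps ten_L form_simps[OF assms(1)] assms(2,3))

lemma bullet_tensor:
  assumes "b1 \<in> G" "b2 \<in> G"
  shows "bullet sA sB B (tensor sA UNIV sA UNIV a1 a2) (tensor sB G sB G b1 b2) =
         tensor fscale L fscale L (ten a1 b1) (ten a2 b2)"
proof (rule ext)
  fix \<phi> :: "('k, 'a, 'b) tens \<Rightarrow> ('k, 'a, 'b) tens \<Rightarrow> 'k"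
  show "bullet sA sB B (tensor sA UNIV sA UNIV a1 a2) (tensor sB G sB G b1 b2) \<phi> =
        tensor fscale L fscale L (ten a1 b1) (ten a2 b2) \<phi>"
  proof (cases "bilin_on fscale L fscale L (*) \<phi>")
    case True
    then show ?thesis
      by (simp add: bullet_def Let_def tensor_def[of sB] tensor_def[of sA UNIV sA]
          tensor_def[of fscale] form_B form_A assms)
  qed (simp add: bullet_def tensor_def[of fscale])
qed

private lemma form_AB:
  assumes \<phi>: "bilin_on fscale L fscale L (*) \<phi>" and u: "u \<in> tensor_space sB G sB G G G"
  shows "bilin_on sA UNIV sA UNIV (*) (\<lambda>a1 a2. u (\<lambda>b1 b2. \<phi> (ten a1 b1) (ten a2 b2)))"
  unfolding bilin_on_def lin_on_def
  by (intro conjI ballI allI tensor_space_add[OF u] tensor_space_scale[OF u] form_B \<phi>)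
    (simp_all add: ten_simps ten_L form_simps[OF \<phi>])

private lemma bullet_bilin:
  assumes A: "comultiplication sA \<Delta>A" and B: "completed_comultiplication sB B \<Delta>B"
  shows "bilin_on sA UNIV sB G (*) (\<lambda>a b. bullet sA sB B (\<Delta>A a) (\<Delta>B b i j) \<phi>)"
proof (cases "bilin_on fscale L fscale L (*) \<phi>")
  case \<phi>: True
  have \<Delta>A: "\<Delta>A a \<in> tensor_space sA UNIV sA UNIV UNIV UNIV" for a
    using A by (simp add: comultiplication_def)
  have \<Delta>B: "\<Delta>B b i j \<in> tensor_space sB G sB G G G" if "b \<in> G" for b
    using B that tensor_space_mono[OF B_sub_G B_sub_G, of sB G sB G i j]
    by (auto simp: completed_comultiplication_def ctensor_space_def)
  note f = form_AB[OF \<phi> \<Delta>B]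
  have add: "\<Delta>B (x + y) i j = \<Delta>B x i j + \<Delta>B y i j" if "x \<in> G" "y \<in> G" for x y
    using B that by (simp add: completed_comultiplication_def lin_on_def)
  have scl: "\<Delta>B (sB c x) i j = fscale c (\<Delta>B x i j)" if "x \<in> G" for c x
    using B that by (simp add: completed_comultiplication_def lin_on_def cscale_def)
  show ?thesis
    unfolding bilin_on_def
  proof (intro conjI ballI)
    fix b assume "b \<in> G"
    show "lin_on sA UNIV (*) (\<lambda>a. bullet sA sB B (\<Delta>A a) (\<Delta>B b i j) \<phi>)"
      using A by (auto simp: comultiplication_def lin_on_def bullet_def Let_def fscale_def)
  next
    fix a
    show "lin_on sB G (*) (\<lambda>b. bullet sA sB B (\<Delta>A a) (\<Delta>B b i j) \<phi>)"
      unfolding lin_on_def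
    proof (intro conjI ballI allI)
      fix x y assume xy: "x \<in> G" "y \<in> G"
      then have "x + y \<in> G" by (rule B.subspace_add[OF G_sub])
      with xy show "bullet sA sB B (\<Delta>A a) (\<Delta>B (x + y) i j) \<phi> =
          bullet sA sB B (\<Delta>A a) (\<Delta>B x i j) \<phi> + bullet sA sB B (\<Delta>A a) (\<Delta>B y i j) \<phi>"
        unfolding bullet_def Let_def if_P[OF \<phi>]
        by (intro tensor_space_add[OF \<Delta>A] f) (simp_all add: add)
    next
      fix c x assume x: "x \<in> G"
      then have "sB c x \<in> G" by (rule B.subspace_scale[OF G_sub])
      with x show "bullet sA sB B (\<Delta>A a) (\<Delta>B (sB c x) i j) \<phi> =
          c * bullet sA sB B (\<Delta>A a) (\<Delta>B x i j) \<phi>"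
        unfolding bullet_def Let_def if_P[OF \<phi>]
        by (intro tensor_space_scale[OF \<Delta>A] f) (simp_all add: scl fscale_def)
    qed
  qed
qed (simp add: bullet_def Let_def bilin_on_def[of sA] lin_on_def[of sA] lin_on_def[of sB])

lemma ex_induced_cobracket:
  assumes "comultiplication sA \<Delta>A" and "completed_comultiplication sB B \<Delta>B"
  shows "\<exists>\<delta>. induced_cobracket sA \<Delta>A sB B \<Delta>B \<delta>"
proof
  define D where "D a b =
    cbullet sA sB B (\<Delta>A a) (\<Delta>B b) - cflip (cbullet sA sB B (\<Delta>A a) (\<Delta>B b))" for a b
  have D: "bilin_on sA UNIV sB G (*) (\<lambda>a b. D a b i j \<phi>)" for i j \<phi>
    using bullet_bilin[OF assms, of i j \<phi>] bullet_bilin[OF assms, of j i "\<lambda>x y. \<phi> y x"]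
    by (auto simp: D_def cbullet_def cflip_def flip_def bilin_on_def lin_on_def algebra_simps)
  show "induced_cobracket sA \<Delta>A sB B \<Delta>B (\<lambda>x i j \<phi>. x (\<lambda>a b. D a b i j \<phi>))"
    unfolding induced_cobracket_def D_def[symmetric]
    using D by (auto simp: lin_on_def cscale_def fscale_def fun_eq_iff tensor_def)
qed

end

end

theory Submission
  imports Defs
begin

text \<open>
  Write \<open>s\<close> and \<open>t\<close> for the transpositions of the first two and of the last two factors of a triple
  tensor product.  Put \<open>L = (\<Delta> \<otimes> id) \<Delta>(a)\<close> and \<open>R = (id \<otimes> \<Delta>) \<Delta>(a)\<close> for \<open>A\<close>, and \<open>\<lambda>\<close>, \<open>\<rho>\<close> for
  the same two composites for \<open>B\<close>.  Since \<open>(id \<otimes> \<Delta>) \<tau> \<Delta>\<close> is a permutation of \<open>(\<Delta> \<otimes> id) \<Delta>\<close>, the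
  Novikov axioms read \<open>R - s R = L - s L\<close> and \<open>t L = L\<close>; the right Novikov axioms read
  \<open>\<lambda> - t \<lambda> = \<rho> - t \<rho>\<close> and \<open>s \<rho> = \<rho>\<close>.

  Let \<open>\<bullet>\<close> also denote the product of triple tensors over \<open>A\<close> and over \<open>B\<close>.  Comultiplying one factor
  commutes with \<open>\<bullet>\<close> (\<open>map_left_bullet\<close>, \<open>map_right_bullet\<close>), so both composites of \<open>\<delta>\<close> at \<open>a \<otimes> b\<close> are
  signed sums of permutations of \<open>X = R \<bullet> \<rho>\<close> and \<open>Y = L \<bullet> \<lambda>\<close> (\<open>cobracket_composites\<close>).  They are
  defined because each multidegree of a composite of \<open>\<delta>\<close> involves only four multidegrees of
  composites of \<open>\<Delta>\<close> on \<open>B\<close>.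

  For the Lie identity, compare \<open>X\<close> and \<open>Y\<close> with the mixed product \<open>Z = L \<bullet> \<rho>\<close>.  As \<open>s\<close> fixes \<open>\<rho>\<close>,
  the first Novikov axiom gives \<open>X - s X = Z - s Z\<close>; as \<open>t\<close> fixes \<open>L\<close>, the first right Novikov axiom
  gives \<open>Y - t Y = Z - t Z\<close>.  The defect of the Lie identity is
  \<open>(1 - t + s t) (X - s X) - (1 - s + t s) (Y - t Y)\<close>, and on replacing \<open>X\<close> and \<open>Y\<close> by \<open>Z\<close> everything
  cancels by the braid relation \<open>s t s = t s t\<close> (\<open>lie_identity_from_braid\<close>).  Both composites are
  additive, so the identity passes from pure tensors to all of \<open>A \<otimes> B\<close>.

  For Laurent polynomials, let \<open>P\<close>, \<open>Q\<close>, \<open>S\<close> be the degrees in the three factors, each increased by \<open>2\<close>.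
  The component of \<open>\<lambda>\<close> is then \<open>P (P + Q + 1)\<close> and that of \<open>\<rho>\<close> is \<open>P Q\<close>, times a pure tensor of powers of \<open>t\<close>
  (\<open>laurent_composites\<close>).  From this the right Novikov axioms are visible.  Conversely, extracting
  coefficients of powers of \<open>t\<close> turns the Lie identity into an identity between permutations of \<open>L\<close> and
  \<open>R\<close> whose coefficients are polynomials in \<open>P\<close>, \<open>Q\<close>, \<open>S\<close> (\<open>laurent_lie_identity\<close>).  At \<open>(1, 0, 0)\<close> it says
  \<open>2 (t L - L) = 0\<close>, and at \<open>(1, 1, 0)\<close>, using \<open>t L = L\<close>, it says \<open>R - s R = L - s L\<close>.

  Elements of tensor products are functionals on forms, and a form is constrained only on the carriers.
  Statements about them are therefore reduced to finite sums of pure tensors, on which the functionals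
  can be evaluated.
\<close>


section \<open>Finite sums of pure tensors\<close>

lemma bilin_onD:
  assumes "bilin_on s V t W r \<phi>" "x \<in> V" "z \<in> W"
  shows "y \<in> V \<Longrightarrow> \<phi> (x + y) z = \<phi> x z + \<phi> y z"
    and "w \<in> W \<Longrightarrow> \<phi> x (z + w) = \<phi> x z + \<phi> x w"
    and "\<phi> (s c x) z = r c (\<phi> x z)"
    and "\<phi> x (t c z) = r c (\<phi> x z)"
  using assms unfolding bilin_on_def lin_on_def by blast+

lemma trilin_onD:
  assumes "trilin_on s V r \<phi>" "x \<in> V" "y \<in> V" "z \<in> V"
  shows "w \<in> V \<Longrightarrow> \<phi> (x + w) y z = \<phi> x y z + \<phi> w y z"
    and "w \<in> V \<Longrightarrow> \<phi> x (y + w) z = \<phi> x y z + \<phi> x w z"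
    and "w \<in> V \<Longrightarrow> \<phi> x y (z + w) = \<phi> x y z + \<phi> x y w"
    and "\<phi> (s c x) y z = r c (\<phi> x y z)"
    and "\<phi> x (s c y) z = r c (\<phi> x y z)"
    and "\<phi> x y (s c z) = r c (\<phi> x y z)"
  using assms unfolding trilin_on_def lin_on_def by blast+

lemma bilin_on_sum:
  assumes "\<And>i. i \<in> I \<Longrightarrow> bilin_on s V t W (*) (\<phi> i)"
  shows "bilin_on s V t W (*) (\<lambda>x y. \<Sum>i\<in>I. \<phi> i x y)"
proof -
  note D = bilin_onD[OF assms]
  show ?thesis
    unfolding bilin_on_def lin_on_def
    by (auto simp: D sum.distrib sum_distrib_left intro!: sum.cong)
qed

lemma trilin_on_sum:
  assumes "\<And>i. i \<in> I \<Longrightarrow> trilin_on s V (*) (\<phi> i)"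
  shows "trilin_on s V (*) (\<lambda>x y z. \<Sum>i\<in>I. \<phi> i x y z)"
proof -
  note D = trilin_onD[OF assms]
  show ?thesis
    unfolding trilin_on_def lin_on_def
    by (auto simp: D sum.distrib sum_distrib_left intro!: sum.cong)
qed

lemma bilin_on_swap: "bilin_on t W s V r (\<lambda>x y. \<phi> y x) \<longleftrightarrow> bilin_on s V t W r \<phi>"
  by (auto simp: bilin_on_def)

lemma trilin_on_swap:
  "trilin_on s V r (\<lambda>x y z. \<phi> y x z) \<longleftrightarrow> trilin_on s V r \<phi>"
  "trilin_on s V r (\<lambda>x y z. \<phi> x z y) \<longleftrightarrow> trilin_on s V r \<phi>"
  by (auto simp: trilin_on_def)

lemma trilin_on_cyclic:
  "trilin_on s V r (\<lambda>x y z. \<phi> y z x) \<longleftrightarrow> trilin_on s V r \<phi>"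
  "trilin_on s V r (\<lambda>x y z. \<phi> z x y) \<longleftrightarrow> trilin_on s V r \<phi>"
  by (auto simp: trilin_on_def)

lemma fscale_apply: "fscale c f x = c * f x"
  by (simp add: fscale_def)

definition tensor3_space :: "('k::field \<Rightarrow> 'v::ab_group_add \<Rightarrow> 'v) \<Rightarrow> 'v set \<Rightarrow> ('k, 'v) tens3 set" where
  "tensor3_space s V = module.span fscale {tensor3 s V x y z | x y z. x \<in> V \<and> y \<in> V \<and> z \<in> V}"

lemma subspace_tensor_space: "module.subspace fscale (tensor_space s V t W V' W')"
  by (simp add: tensor_space_def)

lemma subspace_tensor3_space: "module.subspace fscale (tensor3_space s V)"
  by (simp add: tensor3_space_def)

lemma tensor3_spaceI: "x \<in> V \<Longrightarrow> y \<in> V \<Longrightarrow> z \<in> V \<Longrightarrow> tensor3 s V x y z \<in> tensor3_space s V"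
  unfolding tensor3_space_def by (rule fs.span_base) auto

text \<open>The dummy value \<open>0\<close> of pure tensors at non-bilinear arguments is inherited by their span, so
  equality of tensors may be tested on bilinear forms only.\<close>

lemma tensor_space_eq_0_outside: "T \<in> tensor_space s V t W V' W' \<Longrightarrow> \<not> bilin_on s V t W (*) \<phi> \<Longrightarrow> T \<phi> = 0"
  unfolding tensor_space_def
  by (induction rule: fs.span_induct_alt) (auto simp: tensor_def fscale_def)

lemma tensor3_space_eq_0_outside: "T \<in> tensor3_space s V \<Longrightarrow> \<not> trilin_on s V (*) \<phi> \<Longrightarrow> T \<phi> = 0"
  unfolding tensor3_space_def
  by (induction rule: fs.span_induct_alt) (auto simp: tensor3_def fscale_apply)

lemma tensor_sum_apply:
  "bilin_on s V t W (*) \<phi> \<Longrightarrow> (\<Sum>i\<in>I. tensor s V t W (x i) (y i)) \<phi> = (\<Sum>i\<in>I. \<phi> (x i) (y i))"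
  by (simp add: sum_fun_apply tensor_def)

lemma tensor3_sum_apply:
  "trilin_on s V (*) \<phi> \<Longrightarrow> (\<Sum>i\<in>I. tensor3 s V (x i) (y i) (z i)) \<phi> = (\<Sum>i\<in>I. \<phi> (x i) (y i) (z i))"
  by (simp add: sum_fun_apply tensor3_def)

text \<open>Scalars are absorbed into the first factor, so no coefficients are needed.\<close>

lemma tensor_space_representation:
  assumes "T \<in> tensor_space s V t W V' W'" and "vector_space s" "module.subspace s V'" and "V' \<subseteq> V" "W' \<subseteq> W"
  obtains n :: nat and x y where "T = (\<Sum>i<n. tensor s V t W (x i) (y i))"
    and "\<And>i. i < n \<Longrightarrow> x i \<in> V'" "\<And>i. i < n \<Longrightarrow> y i \<in> W'"
proof -
  interpret s: vector_space s by fact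
  let ?rep = "\<lambda>T (n::nat) x y. T = (\<Sum>i<n. tensor s V t W (x i) (y i)) \<and> (\<forall>i<n. x i \<in> V' \<and> y i \<in> W')"
  have "\<exists>n x y. ?rep T n x y"
    using assms(1) unfolding tensor_space_def
  proof (induction rule: fs.span_induct_alt)
    case base
    show ?case by (rule exI[of _ 0]) simp
  next
    case (step c T0 T)
    then obtain v w n x y where vw: "T0 = tensor s V t W v w" "v \<in> V'" "w \<in> W'" and r: "?rep T n x y"
      by blast
    have cv: "s c v \<in> V'" using vw(2) assms(3) by (rule s.subspace_scale[rotated])
    have w: "w \<in> W" using vw(3) assms(5) by blast
    have "fscale c T0 \<phi> = tensor s V t W (s c v) w \<phi>" for \<phi>
      using bilin_onD(3)[of s V t W "(*)" \<phi> v w c] subsetD[OF assms(4) vw(2)] w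
      by (simp add: vw(1) tensor_def fscale_def)
    then have "fscale c T0 = tensor s V t W (s c v) w" by (rule ext)
    then have "?rep (fscale c T0 + T) (Suc n) (\<lambda>i. if i = n then s c v else x i) (\<lambda>i. if i = n then w else y i)"
      using r cv vw(3) by (auto simp: less_Suc_eq add.commute intro!: sum.cong)
    then show ?case by - (rule exI, rule exI, rule exI)
  qed
  then show thesis using that by blast
qed

lemma tensor3_space_representation:
  assumes "T \<in> tensor3_space s V" and "vector_space s" "module.subspace s V"
  obtains n :: nat and x y z where "T = (\<Sum>i<n. tensor3 s V (x i) (y i) (z i))"
    and "\<And>i. i < n \<Longrightarrow> x i \<in> V" "\<And>i. i < n \<Longrightarrow> y i \<in> V" "\<And>i. i < n \<Longrightarrow> z i \<in> V"
proof -
  interpret s: vector_space s by fact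
  let ?rep = "\<lambda>T (n::nat) x y z. T = (\<Sum>i<n. tensor3 s V (x i) (y i) (z i)) \<and>
      (\<forall>i<n. x i \<in> V \<and> y i \<in> V \<and> z i \<in> V)"
  have "\<exists>n x y z. ?rep T n x y z"
    using assms(1) unfolding tensor3_space_def
  proof (induction rule: fs.span_induct_alt)
    case base
    show ?case by (rule exI[of _ 0]) simp
  next
    case (step c T0 T)
    then obtain u v w n x y z where vw: "T0 = tensor3 s V u v w" "u \<in> V" "v \<in> V" "w \<in> V"
      and r: "?rep T n x y z"
      by blast
    have cu: "s c u \<in> V" using vw(2) assms(3) by (rule s.subspace_scale[rotated])
    have "fscale c T0 \<phi> = tensor3 s V (s c u) v w \<phi>" for \<phi>
      using trilin_onD(4)[of s V "(*)" \<phi> u v w c] vw(2-4)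
      by (simp add: vw(1) tensor3_def fscale_def)
    then have "fscale c T0 = tensor3 s V (s c u) v w" by (rule ext)
    then have "?rep (fscale c T0 + T) (Suc n) (\<lambda>i. if i = n then s c u else x i)
        (\<lambda>i. if i = n then v else y i) (\<lambda>i. if i = n then w else z i)"
      using r cu vw(3,4) by (auto simp: less_Suc_eq add.commute intro!: sum.cong)
    then show ?case by - (rule exI, rule exI, rule exI, rule exI)
  qed
  then show thesis using that by blast
qed

lemma tensor_space_induct:
  assumes "T \<in> tensor_space s V t W V' W'" and "vector_space s" "module.subspace s V'" and "V' \<subseteq> V" "W' \<subseteq> W"
    and "P 0"
    and step: "\<And>v w T. v \<in> V' \<Longrightarrow> w \<in> W' \<Longrightarrow> T \<in> tensor_space s V t W V' W' \<Longrightarrow> P T \<Longrightarrow>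
      P (tensor s V t W v w + T)"
  shows "P T"
proof -
  obtain n :: nat and x y where T: "T = (\<Sum>i<n. tensor s V t W (x i) (y i))"
    "\<And>i. i < n \<Longrightarrow> x i \<in> V'" "\<And>i. i < n \<Longrightarrow> y i \<in> W'"
    by (rule tensor_space_representation[OF assms(1-5)]) blast
  have "P (\<Sum>i<m. tensor s V t W (x i) (y i)) \<and>
      (\<Sum>i<m. tensor s V t W (x i) (y i)) \<in> tensor_space s V t W V' W'" if "m \<le> n" for m
    using that
  proof (induction m)
    case 0
    show ?case
      using \<open>P 0\<close> fs.subspace_0[OF subspace_tensor_space]
      by (simp only: lessThan_0 sum.empty simp_thms)
  next
    case (Suc m)
    then have m: "x m \<in> V'" "y m \<in> W'" using T(2,3) by auto
    have eq: "(\<Sum>i<Suc m. tensor s V t W (x i) (y i)) = tensor s V t W (x m) (y m) + (\<Sum>i<m. tensor s V t W (x i) (y i))"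
      by (subst sum.lessThan_Suc) (rule add.commute)
    show ?case
      unfolding eq using Suc
      by (intro conjI step fs.subspace_add[OF subspace_tensor_space] tensor_spaceI m) auto
  qed
  then show ?thesis unfolding T(1) by blast
qed

section \<open>Permuting tensor factors\<close>

lemma flip_add: "flip (S + T) = flip S + flip T"
  and flip_diff: "flip (S - T) = flip S - flip T"
  and flip_fscale: "flip (fscale c T) = fscale c (flip T)"
  and flip_flip: "flip (flip T) = T"
  by (auto simp: flip_def fscale_def fun_eq_iff)

lemma flip_tensor_space:
  assumes "T \<in> tensor_space s V t W V' W'"
  shows "flip T \<in> tensor_space t W s V W' V'"
  using assms unfolding tensor_space_def[of s]
proof (induction rule: fs.span_induct_alt)
  case base
  show ?case using fs.subspace_0[OF subspace_tensor_space] by (simp add: flip_def zero_fun_def)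
next
  case (step c T0 T)
  then obtain v w where T0: "T0 = tensor s V t W v w" "v \<in> V'" "w \<in> W'" by blast
  have "flip T0 \<in> tensor_space t W s V W' V'"
    unfolding T0(1) flip_tensor by (rule tensor_spaceI[OF T0(3,2)])
  with step show ?case
    unfolding flip_add flip_fscale
    by (intro fs.subspace_add[OF subspace_tensor_space] fs.subspace_scale[OF subspace_tensor_space])
qed

lemma flip12_add: "flip12 (S + T) = flip12 S + flip12 T"
  and flip12_diff: "flip12 (S - T) = flip12 S - flip12 T"
  and flip12_fscale: "flip12 (fscale c T) = fscale c (flip12 T)"
  and flip12_0: "flip12 0 = 0"
  and flip12_flip12: "flip12 (flip12 T) = T"
  and flip23_add: "flip23 (S + T) = flip23 S + flip23 T"
  and flip23_diff: "flip23 (S - T) = flip23 S - flip23 T"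
  and flip23_fscale: "flip23 (fscale c T) = fscale c (flip23 T)"
  and flip23_0: "flip23 0 = 0"
  by (auto simp: flip12_def flip23_def fscale_def fun_eq_iff)

lemma flip12_sum: "flip12 (\<Sum>i\<in>I. T i) = (\<Sum>i\<in>I. flip12 (T i))"
  and flip23_sum: "flip23 (\<Sum>i\<in>I. T i) = (\<Sum>i\<in>I. flip23 (T i))"
  by (auto simp: flip12_def flip23_def sum_fun_apply fun_eq_iff)

lemma flip12_tensor3: "flip12 (tensor3 s V x y z) = tensor3 s V y x z"
  and flip23_tensor3: "flip23 (tensor3 s V x y z) = tensor3 s V x z y"
  by (rule ext, simp only: flip12_def flip23_def tensor3_def, subst trilin_on_swap, rule refl)+

lemma flip12_tensor3_space:
  assumes "T \<in> tensor3_space s V"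
  shows "flip12 T \<in> tensor3_space s V"
  using assms unfolding tensor3_space_def
proof (induction rule: fs.span_induct_alt)
  case base
  show ?case unfolding flip12_0 by (rule fs.span_zero)
next
  case (step c T0 T)
  then obtain x y z where "T0 = tensor3 s V x y z" "x \<in> V" "y \<in> V" "z \<in> V" by blast
  then have "flip12 T0 \<in> fs.span {tensor3 s V x y z |x y z. x \<in> V \<and> y \<in> V \<and> z \<in> V}"
    by (intro fs.span_base) (auto simp: flip12_tensor3)
  with step show ?case
    unfolding flip12_add flip12_fscale by (intro fs.span_add fs.span_scale)
qed

lemma flip23_tensor3_space:
  assumes "T \<in> tensor3_space s V"
  shows "flip23 T \<in> tensor3_space s V"
  using assms unfolding tensor3_space_def
proof (induction rule: fs.span_induct_alt)
  case base
  show ?case unfolding flip23_0 by (rule fs.span_zero)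
next
  case (step c T0 T)
  then obtain x y z where "T0 = tensor3 s V x y z" "x \<in> V" "y \<in> V" "z \<in> V" by blast
  then have "flip23 T0 \<in> fs.span {tensor3 s V x y z |x y z. x \<in> V \<and> y \<in> V \<and> z \<in> V}"
    by (intro fs.span_base) (auto simp: flip23_tensor3)
  with step show ?case
    unfolding flip23_add flip23_fscale by (intro fs.span_add fs.span_scale)
qed

lemma cflip12_add: "cflip12 (u + v) = cflip12 u + cflip12 v"
  and cflip12_diff: "cflip12 (u - v) = cflip12 u - cflip12 v"
  and cflip23_add: "cflip23 (u + v) = cflip23 u + cflip23 v"
  and cflip23_diff: "cflip23 (u - v) = cflip23 u - cflip23 v"
  and cflip12_0: "cflip12 0 = 0"
  and cflip12_cflip12: "cflip12 (cflip12 u) = u"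
  and cflip23_cflip23: "cflip23 (cflip23 u) = u"
  and cflip_braid: "cflip12 (cflip23 (cflip12 u)) = cflip23 (cflip12 (cflip23 u))"
  by (intro ext, simp add: cflip12_def cflip23_def flip12_def flip23_def)+

section \<open>Comultiplying one tensor factor\<close>

text \<open>What a map has to satisfy in order to be applied to one tensor factor.\<close>

definition tensor_map :: "('k::field \<Rightarrow> 'v::ab_group_add \<Rightarrow> 'v) \<Rightarrow> 'v set \<Rightarrow> ('v \<Rightarrow> ('k, 'v, 'v) tens) \<Rightarrow> bool" where
  "tensor_map s V f \<longleftrightarrow> lin_on s V fscale f \<and> (\<forall>c\<in>V. f c \<in> tensor_space s V s V V V)"

lemma tensor_mapD:
  assumes "tensor_map s V f" "c \<in> V"
  shows "f c \<in> tensor_space s V s V V V"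
    and "d \<in> V \<Longrightarrow> f (c + d) = f c + f d"
    and "f (s k c) = fscale k (f c)"
  using assms by (simp_all add: tensor_map_def lin_on_def)

lemma tensor_map_flip:
  assumes "tensor_map s V f"
  shows "tensor_map s V (\<lambda>c. flip (f c))"
  unfolding tensor_map_def lin_on_def
  using tensor_mapD(2,3)[OF assms]
  by (auto simp only: flip_add flip_fscale intro!: flip_tensor_space tensor_mapD(1)[OF assms])

text \<open>Every composite of \<open>\<delta>\<close> is reduced by these rules to permutations of the two unflipped ones.\<close>

lemma map_left_flip: "map_left s V f (flip T) = flip23 (flip12 (map_right s V f T))"
  and map_right_flip: "map_right s V f (flip T) = flip12 (flip23 (map_left s V f T))"
  and map_left_flip_comp: "map_left s V (\<lambda>c. flip (f c)) T = flip12 (map_left s V f T)"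
  and map_right_flip_comp: "map_right s V (\<lambda>c. flip (f c)) T = flip23 (map_right s V f T)"
proof -
  have swap: "trilin_on s V (*) (\<lambda>x y z. \<phi> y x z) = trilin_on s V (*) \<phi>"
    "trilin_on s V (*) (\<lambda>x y z. \<phi> x z y) = trilin_on s V (*) \<phi>"
    "trilin_on s V (*) (\<lambda>x y z. \<phi> y z x) = trilin_on s V (*) \<phi>"
    "trilin_on s V (*) (\<lambda>x y z. \<phi> z x y) = trilin_on s V (*) \<phi>" for \<phi>
    by (rule trilin_on_swap trilin_on_cyclic)+
  show "map_left s V f (flip T) = flip23 (flip12 (map_right s V f T))"
    "map_right s V f (flip T) = flip12 (flip23 (map_left s V f T))"
    "map_left s V (\<lambda>c. flip (f c)) T = flip12 (map_left s V f T)"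
    "map_right s V (\<lambda>c. flip (f c)) T = flip23 (map_right s V f T)"
    by (rule ext, simp only: map_left_def map_right_def flip_def flip12_def flip23_def,
        subst swap, rule refl)+
qed

text \<open>Reduces statements about \<open>id \<otimes> f\<close> to those about \<open>f \<otimes> id\<close>.\<close>

lemma map_right_eq_map_left: "map_right s V f T = flip12 (flip23 (map_left s V f (flip T)))"
  using map_right_flip[of s V f "flip T"] by (simp only: flip_flip)

lemma map_left_add: "map_left s V f (S + T) = map_left s V f S + map_left s V f T"
  and map_left_diff: "map_left s V f (S - T) = map_left s V f S - map_left s V f T"
  and map_left_0: "map_left s V f 0 = 0"
  and map_right_add: "map_right s V f (S + T) = map_right s V f S + map_right s V f T"
  and map_right_diff: "map_right s V f (S - T) = map_right s V f S - map_right s V f T"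
  and map_right_0: "map_right s V f 0 = 0"
  by (auto simp: map_left_def map_right_def fun_eq_iff)

lemma map_left_fscale: "map_left s V f (fscale c T) = fscale c (map_left s V f T)"
  and map_right_fscale: "map_right s V f (fscale c T) = fscale c (map_right s V f T)"
  by (auto simp: map_left_def map_right_def fscale_def fun_eq_iff)

lemma map_left_sum: "map_left s V f (\<Sum>i\<in>I. T i) = (\<Sum>i\<in>I. map_left s V f (T i))"
  by (rule ext) (simp add: map_left_def sum_fun_apply)

lemma map_left_pure:
  assumes f: "tensor_map s V f" and cd: "c \<in> V" "d \<in> V" and V: "vector_space s" "module.subspace s V"
  shows "map_left s V f (tensor s V s V c d) \<phi> = (if trilin_on s V (*) \<phi> then f c (\<lambda>x y. \<phi> x y d) else 0)"
    and "map_left s V f (tensor s V s V c d) \<in> tensor3_space s V"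
proof -
  obtain n :: nat and x y where fc: "f c = (\<Sum>i<n. tensor s V s V (x i) (y i))"
    "\<And>i. i < n \<Longrightarrow> x i \<in> V" "\<And>i. i < n \<Longrightarrow> y i \<in> V"
    by (rule tensor_space_representation[OF tensor_mapD(1)[OF f cd(1)] V order_refl order_refl]) blast
  have m: "map_left s V f (tensor s V s V c d) = (\<Sum>i<n. tensor3 s V (x i) (y i) d)"
    by (rule map_left_tensor[where I = "{..<n}" and x = x and y = y and f = f and s = s and V = V,
          OF _ _ cd fc(1) _ _ V])
      (use f fc in \<open>auto simp: tensor_map_def\<close>)
  show "map_left s V f (tensor s V s V c d) \<in> tensor3_space s V"
    unfolding m using fc(2,3) cd by (intro fs.subspace_sum[OF subspace_tensor3_space] tensor3_spaceI) auto
  show "map_left s V f (tensor s V s V c d) \<phi> = (if trilin_on s V (*) \<phi> then f c (\<lambda>x y. \<phi> x y d) else 0)"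
  proof (cases "trilin_on s V (*) \<phi>")
    case True
    then have "bilin_on s V s V (*) (\<lambda>x y. \<phi> x y d)"
      using cd(2) by (auto simp: bilin_on_def trilin_on_def)
    then show ?thesis using True by (simp only: m fc(1) tensor3_sum_apply tensor_sum_apply if_True)
  qed (simp add: map_left_def)
qed

lemma map_right_pure:
  assumes f: "tensor_map s V f" and cd: "c \<in> V" "d \<in> V" and V: "vector_space s" "module.subspace s V"
  shows "map_right s V f (tensor s V s V c d) \<phi> = (if trilin_on s V (*) \<phi> then f d (\<lambda>x y. \<phi> c x y) else 0)"
  unfolding map_right_eq_map_left flip_tensor flip12_def flip23_def map_left_pure(1)[OF f cd(2,1) V]
  by (subst trilin_on_cyclic) (rule refl)

lemma map_left_tensor3_space:
  assumes "tensor_map s V f" "T \<in> tensor_space s V s V V V" "vector_space s" "module.subspace s V"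
  shows "map_left s V f T \<in> tensor3_space s V"
  using assms(2,3,4) order_refl order_refl
proof (rule tensor_space_induct)
  show "map_left s V f 0 \<in> tensor3_space s V"
    unfolding map_left_0 by (rule fs.subspace_0[OF subspace_tensor3_space])
next
  fix v w T assume "v \<in> V" "w \<in> V" "map_left s V f T \<in> tensor3_space s V"
  then show "map_left s V f (tensor s V s V v w + T) \<in> tensor3_space s V"
    unfolding map_left_add
    by (intro fs.subspace_add[OF subspace_tensor3_space] map_left_pure(2)[OF assms(1) _ _ assms(3,4)])
qed

lemma map_right_tensor3_space:
  assumes "tensor_map s V f" "T \<in> tensor_space s V s V V V" "vector_space s" "module.subspace s V"
  shows "map_right s V f T \<in> tensor3_space s V"
  unfolding map_right_eq_map_left
  by (intro flip12_tensor3_space flip23_tensor3_space map_left_tensor3_space flip_tensor_space assms)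

text \<open>Subtraction of maps is assumed only on the carrier, because the cobracket is determined only there.\<close>

lemma map_left_diff_fun:
  assumes "tensor_map s V f" "tensor_map s V g" "tensor_map s V h" and h: "\<And>c. c \<in> V \<Longrightarrow> h c = f c - g c"
    and "T \<in> tensor_space s V s V V V" "vector_space s" "module.subspace s V"
  shows "map_left s V h T = map_left s V f T - map_left s V g T"
  using assms(5-) order_refl order_refl
proof (rule tensor_space_induct)
  show "map_left s V h 0 = map_left s V f 0 - map_left s V g 0"
    unfolding map_left_0 by (rule diff_0_right[symmetric])
next
  fix v w T assume vw: "v \<in> V" "w \<in> V" and T: "map_left s V h T = map_left s V f T - map_left s V g T"
  note p = map_left_pure(1)[OF _ vw assms(6,7)]
  have "map_left s V h (tensor s V s V v w) = map_left s V f (tensor s V s V v w) - map_left s V g (tensor s V s V v w)"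
    by (rule ext) (simp add: p[OF assms(1)] p[OF assms(2)] p[OF assms(3)] h[OF vw(1)])
  then show "map_left s V h (tensor s V s V v w + T) =
      map_left s V f (tensor s V s V v w + T) - map_left s V g (tensor s V s V v w + T)"
    unfolding map_left_add T by (simp only: add_diff_add)
qed

lemma map_right_diff_fun:
  assumes "tensor_map s V f" "tensor_map s V g" "tensor_map s V h" and "\<And>c. c \<in> V \<Longrightarrow> h c = f c - g c"
    and "T \<in> tensor_space s V s V V V" "vector_space s" "module.subspace s V"
  shows "map_right s V h T = map_right s V f T - map_right s V g T"
  by (simp only: map_right_eq_map_left map_left_diff_fun[OF assms(1-4) flip_tensor_space[OF assms(5)] assms(6,7)]
      flip12_diff flip23_diff)

section \<open>Composites in completed tensor products\<close>

text \<open>Any finite set of indices that contains the support may replace it; this allows one to add composites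
  with different supports.\<close>

lemma cleft_eq_sum:
  assumes "finite F" "{i. cleft_term s C \<Delta> u p q r i \<noteq> 0} \<subseteq> F"
  shows "cleft s C \<Delta> u p q r = (\<Sum>i\<in>F. cleft_term s C \<Delta> u p q r i)"
  unfolding cleft_def using assms by (intro sum.mono_neutral_left) auto

lemma cright_eq_sum:
  assumes "finite F" "{i. cright_term s C \<Delta> u p q r i \<noteq> 0} \<subseteq> F"
  shows "cright s C \<Delta> u p q r = (\<Sum>i\<in>F. cright_term s C \<Delta> u p q r i)"
  unfolding cright_def using assms by (intro sum.mono_neutral_left) auto

lemma cleft_add:
  assumes "cleft_defined s C \<Delta> u" "cleft_defined s C \<Delta> v"
  shows "cleft_defined s C \<Delta> (u + v)" and "cleft s C \<Delta> (u + v) = cleft s C \<Delta> u + cleft s C \<Delta> v"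
proof -
  have t: "cleft_term s C \<Delta> (u + v) p q r i = cleft_term s C \<Delta> u p q r i + cleft_term s C \<Delta> v p q r i" for p q r i
    by (simp only: cleft_term_def plus_fun_apply map_left_add)
  define F where "F p q r = {i. cleft_term s C \<Delta> u p q r i \<noteq> 0} \<union> {i. cleft_term s C \<Delta> v p q r i \<noteq> 0}" for p q r
  have fin: "finite (F p q r)" for p q r
    using assms unfolding F_def cleft_defined_def by blast
  have sub: "{i. cleft_term s C \<Delta> (u + v) p q r i \<noteq> 0} \<subseteq> F p q r" for p q r
    unfolding F_def t by (auto simp only: mem_Collect_eq Un_iff add_0_left)
  show "cleft_defined s C \<Delta> (u + v)"
    unfolding cleft_defined_def using finite_subset[OF sub fin] by blast
  have "cleft s C \<Delta> (u + v) p q r = cleft s C \<Delta> u p q r + cleft s C \<Delta> v p q r" for p q r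
  proof -
    have "{i. cleft_term s C \<Delta> u p q r i \<noteq> 0} \<subseteq> F p q r" "{i. cleft_term s C \<Delta> v p q r i \<noteq> 0} \<subseteq> F p q r"
      by (auto simp: F_def)
    then show ?thesis
      by (simp only: cleft_eq_sum[OF fin sub] cleft_eq_sum[OF fin] t sum.distrib)
  qed
  then show "cleft s C \<Delta> (u + v) = cleft s C \<Delta> u + cleft s C \<Delta> v"
    by (intro ext) (simp only: plus_fun_apply)
qed

lemma cright_add:
  assumes "cright_defined s C \<Delta> u" "cright_defined s C \<Delta> v"
  shows "cright_defined s C \<Delta> (u + v)" and "cright s C \<Delta> (u + v) = cright s C \<Delta> u + cright s C \<Delta> v"
proof -
  have t: "cright_term s C \<Delta> (u + v) p q r i = cright_term s C \<Delta> u p q r i + cright_term s C \<Delta> v p q r i" for p q r i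
    by (simp only: cright_term_def plus_fun_apply map_right_add)
  define F where "F p q r = {i. cright_term s C \<Delta> u p q r i \<noteq> 0} \<union> {i. cright_term s C \<Delta> v p q r i \<noteq> 0}" for p q r
  have fin: "finite (F p q r)" for p q r
    using assms unfolding F_def cright_defined_def by blast
  have sub: "{i. cright_term s C \<Delta> (u + v) p q r i \<noteq> 0} \<subseteq> F p q r" for p q r
    unfolding F_def t by (auto simp only: mem_Collect_eq Un_iff add_0_left)
  show "cright_defined s C \<Delta> (u + v)"
    unfolding cright_defined_def using finite_subset[OF sub fin] by blast
  have "cright s C \<Delta> (u + v) p q r = cright s C \<Delta> u p q r + cright s C \<Delta> v p q r" for p q r
  proof -
    have "{i. cright_term s C \<Delta> u p q r i \<noteq> 0} \<subseteq> F p q r" "{i. cright_term s C \<Delta> v p q r i \<noteq> 0} \<subseteq> F p q r"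
      by (auto simp: F_def)
    then show ?thesis
      by (simp only: cright_eq_sum[OF fin sub] cright_eq_sum[OF fin] t sum.distrib)
  qed
  then show "cright s C \<Delta> (u + v) = cright s C \<Delta> u + cright s C \<Delta> v"
    by (intro ext) (simp only: plus_fun_apply)
qed

lemma cleft_0: "cleft_defined s C \<Delta> 0" "cleft s C \<Delta> 0 = 0"
  and cright_0: "cright_defined s C \<Delta> 0" "cright s C \<Delta> 0 = 0"
proof -
  have t: "cleft_term s C \<Delta> 0 p q r i = 0" "cright_term s C \<Delta> 0 p q r i = 0" for p q r i
    by (simp_all only: cleft_term_def cright_term_def zero_fun_apply map_left_0 map_right_0)
  show "cleft_defined s C \<Delta> 0" "cright_defined s C \<Delta> 0"
    by (simp_all add: cleft_defined_def cright_defined_def t)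
  show "cleft s C \<Delta> 0 = 0" "cright s C \<Delta> 0 = 0"
    by (simp_all add: cleft_def cright_def t fun_eq_iff)
qed

text \<open>The homogeneous components of an element. They exist because the sum is spanned by the summands, and
  are linear because they are unique.\<close>

lemma graded_projections:
  assumes "graded_space s C"
  obtains \<pi> where "\<And>i. lin_on s (gspace s C) s (\<pi> i)" and "\<And>i b. b \<in> gspace s C \<Longrightarrow> \<pi> i b \<in> C i"
    and "\<And>i b. b \<in> C i \<Longrightarrow> \<pi> i b = b"
    and "\<And>i j b. b \<in> C j \<Longrightarrow> i \<noteq> j \<Longrightarrow> \<pi> i b = 0"
proof -
  interpret vector_space s using assms by (simp add: graded_space_def)
  have C: "subspace (C i)" for i using assms by (simp add: graded_space_def)
  \<comment> \<open>The family \<open>c\<close> is a decomposition of \<open>b\<close> into homogeneous components.\<close>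
  let ?dec = "\<lambda>c b. (\<forall>i. c i \<in> C i) \<and> finite {i. c i \<noteq> 0} \<and> b = Sum_any c"
  have add: "?dec (\<lambda>i. c i + d i) (b + b')" if "?dec c b" "?dec d b'" for b b' c d
  proof -
    have "finite {i. c i + d i \<noteq> 0}"
      by (rule finite_subset[of _ "{i. c i \<noteq> 0} \<union> {i. d i \<noteq> 0}"]) (use that in auto)
    then show ?thesis using that C by (auto simp: Sum_any.distrib subspace_add)
  qed
  have scl: "?dec (\<lambda>i. s k (c i)) (s k b)" if "?dec c b" for k b c
  proof -
    have sub: "{i. s k (c i) \<noteq> 0} \<subseteq> {i. c i \<noteq> 0}" by auto
    have "s k (Sum_any c) = Sum_any (\<lambda>i. s k (c i))"
      using that Sum_any.expand_superset[OF _ sub]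
      by (simp add: Sum_any.expand_set[of c] scale_sum_right)
    then show ?thesis using that C finite_subset[OF sub] by (auto simp: subspace_scale)
  qed
  have single: "?dec (\<lambda>j. if j = i then b else 0) b" if "b \<in> C i" for i b
    using that C by (auto simp: subspace_0)
  have uniq: "c = d" if "?dec c b" "?dec d b" for b c d
  proof -
    define I where "I = {i. c i \<noteq> 0} \<union> {i. d i \<noteq> 0}"
    have I: "finite I" using that by (simp add: I_def)
    have "Sum_any c = sum c I" "Sum_any d = sum d I"
      by (intro Sum_any.expand_superset I; auto simp: I_def)+
    moreover have "b = Sum_any c" "b = Sum_any d" using that by blast+
    ultimately have "sum c I = sum d I" by (simp only:)
    then have "(\<Sum>i\<in>I. c i - d i) = 0" by (simp only: sum_subtractf right_minus_eq)
    moreover have "c i - d i \<in> C i" for i using that by (intro subspace_diff[OF C]) blast+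
    ultimately have 0: "\<forall>i\<in>I. c i - d i = 0"
      using assms[unfolded graded_space_def, THEN conjunct2, THEN conjunct2, THEN spec[of _ I],
          THEN spec[of _ "\<lambda>i. c i - d i"]] I by blast
    have "c i = d i" for i
    proof (cases "i \<in> I")
      case True
      then show ?thesis using bspec[OF 0 True] by (simp only: right_minus_eq)
    qed (simp add: I_def)
    then show ?thesis by (rule ext)
  qed
  have ex: "\<exists>c. ?dec c b" if "b \<in> gspace s C" for b
    using that unfolding gspace_def
  proof (induction rule: span_induct_alt)
    case base
    show ?case using C by (intro exI[of _ "\<lambda>_. 0"]) (auto simp: subspace_0)
  next
    case (step k x y)
    then obtain i c where "x \<in> C i" and c: "?dec c y" by blast
    then show ?case
      using add[OF scl[OF single, of x i k] c] by (intro exI[of _ "\<lambda>j. s k (if j = i then x else 0) + c j"])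
  qed
  define \<pi> where "\<pi> i b = (SOME c. ?dec c b) i" for i b
  have \<pi>: "\<pi> i b = c i" if "?dec c b" for b c i
    unfolding \<pi>_def using uniq[OF someI[of "\<lambda>c. ?dec c b", OF that] that] by (rule fun_cong)
  have "lin_on s (gspace s C) s (\<pi> i)" for i
    unfolding lin_on_def
  proof (intro conjI ballI allI)
    fix x assume "x \<in> gspace s C"
    then obtain c where c: "?dec c x" using ex by blast
    show "\<pi> i (s k x) = s k (\<pi> i x)" for k
      by (simp only: \<pi>[OF c] \<pi>[OF scl[OF c]])
    fix y assume "y \<in> gspace s C"
    then obtain d where d: "?dec d y" using ex by blast
    show "\<pi> i (x + y) = \<pi> i x + \<pi> i y"
      by (simp only: \<pi>[OF c] \<pi>[OF d] \<pi>[OF add[OF c d]])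
  qed
  moreover have "\<pi> i b \<in> C i" if "b \<in> gspace s C" for i b
  proof -
    from ex[OF that] obtain c where c: "?dec c b" by blast
    show ?thesis unfolding \<pi>[OF c] using c by blast
  qed
  moreover have "\<pi> i b = b" if "b \<in> C i" for i b using \<pi>[OF single[OF that], of i] by simp
  moreover have "\<pi> i b = 0" if "b \<in> C j" "i \<noteq> j" for i j b using \<pi>[OF single[OF that(1)], of i] that(2) by simp
  ultimately show thesis by (rule that)
qed

section \<open>The Lie identity in the group algebra of the symmetric group\<close>

text \<open>With \<open>s\<close> and \<open>t\<close> the two flips, \<open>r - s r - l\<close> is \<open>(1 - t + s t) (X - s X) - (1 - s + t s) (Y - t Y)\<close>.
  Replacing \<open>X\<close> and \<open>Y\<close> by \<open>Z\<close>, both terms become the alternating sum of all permutations of \<open>Z\<close>,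
  by the braid relation.\<close>

lemma lie_identity_from_braid:
  fixes X Y Z :: "('k::field, 'v) ctens3"
  assumes X: "X - cflip12 X = Z - cflip12 Z" and Y: "Y - cflip23 Y = Z - cflip23 Z"
  defines "r \<equiv> X - cflip23 X - cflip12 (cflip23 Y) + cflip23 (cflip12 (cflip23 Y))"
    and "l \<equiv> Y - cflip12 Y - cflip23 (cflip12 X) + cflip12 (cflip23 (cflip12 X))"
  shows "r - cflip12 r = l"
proof -
  define DX where "DX = X - cflip12 X"
  define DY where "DY = Y - cflip23 Y"
  \<comment> \<open>Here \<open>s t s t = t s t t = t s\<close>.\<close>
  have stst: "cflip12 (cflip23 (cflip12 (cflip23 Y))) = cflip23 (cflip12 Y)"
    using cflip_braid[of "cflip23 Y"] by (simp only: cflip23_cflip23)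
  have "r - cflip12 r - l = (DX - cflip23 DX + cflip12 (cflip23 DX)) - (DY - cflip12 DY + cflip23 (cflip12 DY))"
    unfolding r_def l_def DX_def DY_def
    by (simp only: cflip12_diff cflip23_diff cflip12_add cflip23_add cflip12_cflip12 cflip23_cflip23 stst)
      (simp only: algebra_simps)
  also have "\<dots> = 0"
    unfolding DX_def DY_def X Y
    by (simp only: cflip12_diff cflip23_diff cflip_braid) (simp only: algebra_simps diff_self)
  finally show ?thesis by (simp only: right_minus_eq)
qed

section \<open>Multiplying tensors over the two factors\<close>

text \<open>The triple analogue of \<open>bullet\<close>: it sends \<open>(a\<^sub>1 \<otimes> a\<^sub>2 \<otimes> a\<^sub>3, b\<^sub>1 \<otimes> b\<^sub>2 \<otimes> b\<^sub>3)\<close> to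
  \<open>(a\<^sub>1 \<otimes> b\<^sub>1) \<otimes> (a\<^sub>2 \<otimes> b\<^sub>2) \<otimes> (a\<^sub>3 \<otimes> b\<^sub>3)\<close>.\<close>

definition bullet3 :: "('k::field \<Rightarrow> 'a::ab_group_add \<Rightarrow> 'a)
    \<Rightarrow> ('k \<Rightarrow> 'b::ab_group_add \<Rightarrow> 'b) \<Rightarrow> (int \<Rightarrow> 'b set)
    \<Rightarrow> ('k, 'a) tens3 \<Rightarrow> ('k, 'b) tens3 \<Rightarrow> ('k, ('k, 'a, 'b) tens) tens3" where
  "bullet3 sA sB B S T =
     (\<lambda>\<phi>. let ten = tensor sA UNIV sB (gspace sB B)
          in if trilin_on fscale (gspace fscale (tensor_grading sA sB B)) (*) \<phi>
             then S (\<lambda>a1 a2 a3. T (\<lambda>b1 b2 b3. \<phi> (ten a1 b1) (ten a2 b2) (ten a3 b3))) else 0)"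

lemma flip_bullet: "flip (bullet sA sB B S T) = bullet sA sB B (flip S) (flip T)"
  by (rule ext, simp only: bullet_def flip_def Let_def, subst bilin_on_swap, rule refl)

lemma flip12_bullet3: "flip12 (bullet3 sA sB B S T) = bullet3 sA sB B (flip12 S) (flip12 T)"
  and flip23_bullet3: "flip23 (bullet3 sA sB B S T) = bullet3 sA sB B (flip23 S) (flip23 T)"
  by (rule ext, simp only: bullet3_def flip12_def flip23_def Let_def, subst trilin_on_swap, rule refl)+

lemma cflip12_bullet3: "cflip12 (\<lambda>p q r. bullet3 sA sB B S (w p q r)) = (\<lambda>p q r. bullet3 sA sB B (flip12 S) (cflip12 w p q r))"
  and cflip23_bullet3: "cflip23 (\<lambda>p q r. bullet3 sA sB B S (w p q r)) = (\<lambda>p q r. bullet3 sA sB B (flip23 S) (cflip23 w p q r))"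
  by (simp_all only: cflip12_def cflip23_def flip12_bullet3 flip23_bullet3)

lemma bullet3_diff_left: "bullet3 sA sB B (S - S') T = bullet3 sA sB B S T - bullet3 sA sB B S' T"
  by (auto simp: bullet3_def Let_def fun_eq_iff)

lemma bullet3_sum_left:
  "bullet3 sA sB B (\<Sum>i\<in>I. S i) T = (\<Sum>i\<in>I. bullet3 sA sB B (S i) T)"
  by (rule ext) (simp add: bullet3_def Let_def sum_fun_apply)

lemma sum_pairs:
  fixes F :: "'i \<Rightarrow> 'j \<Rightarrow> 'c::comm_monoid_add"
  shows "(\<Sum>i\<in>I. \<Sum>j\<in>J. F i j) = (\<Sum>z\<in>I \<times> J. F (fst z) (snd z))"
  by (simp add: sum.cartesian_product case_prod_unfold)

context
  fixes sA :: "'k::field \<Rightarrow> 'a::ab_group_add \<Rightarrow> 'a"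
    and sB :: "'k \<Rightarrow> 'b::ab_group_add \<Rightarrow> 'b" and B :: "int \<Rightarrow> 'b set"
  assumes sA: "vector_space sA" and gB: "graded_space sB B"
begin

interpretation A: vector_space sA by (rule sA)
interpretation B: vector_space sB using gB by (simp add: graded_space_def)

private abbreviation (input) "G \<equiv> gspace sB B"
private abbreviation (input) "ten \<equiv> tensor sA UNIV sB G"
private abbreviation (input) "L \<equiv> gspace fscale (tensor_grading sA sB B)"

private lemma sub: "A.subspace UNIV" "B.subspace G" "fs.subspace L"
  by (simp_all add: gspace_def)

private lemma ten_bilin: "bilin_on sA UNIV sB G fscale ten"
  by (rule tensor_bilin[OF sA sub(1) B.vector_space_axioms sub(2)])

private lemma ten_L: "b \<in> G \<Longrightarrow> ten a b \<in> L"
  unfolding gspace_tensor_grading[OF sA gB] by (rule tensor_spaceI) auto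

private lemma ten_simps:
  "b \<in> G \<Longrightarrow> ten (a + a') b = ten a b + ten a' b"
  "b \<in> G \<Longrightarrow> ten (sA c a) b = fscale c (ten a b)"
  "b \<in> G \<Longrightarrow> b' \<in> G \<Longrightarrow> ten a (b + b') = ten a b + ten a b'"
  "b \<in> G \<Longrightarrow> ten a (sB c b) = fscale c (ten a b)"
  using ten_bilin unfolding bilin_on_def lin_on_def by blast+

private lemma form2_B:
  assumes "bilin_on fscale L fscale L (*) \<phi>"
  shows "bilin_on sB G sB G (*) (\<lambda>b1 b2. \<phi> (ten a1 b1) (ten a2 b2))"
  unfolding bilin_on_def lin_on_def
  by (simp add: ten_simps ten_L bilin_onD[OF assms])

private lemma form2_A:
  assumes "bilin_on fscale L fscale L (*) \<phi>" "b1 \<in> G" "b2 \<in> G"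
  shows "bilin_on sA UNIV sA UNIV (*) (\<lambda>a1 a2. \<phi> (ten a1 b1) (ten a2 b2))"
  unfolding bilin_on_def lin_on_def
  by (simp add: ten_simps ten_L bilin_onD[OF assms(1)] assms(2,3))

private lemma form3_B:
  assumes "trilin_on fscale L (*) \<phi>"
  shows "trilin_on sB G (*) (\<lambda>b1 b2 b3. \<phi> (ten a1 b1) (ten a2 b2) (ten a3 b3))"
  unfolding trilin_on_def lin_on_def
  by (simp add: ten_simps ten_L trilin_onD[OF assms])

private lemma form3_A:
  assumes "trilin_on fscale L (*) \<phi>" "b1 \<in> G" "b2 \<in> G" "b3 \<in> G"
  shows "trilin_on sA UNIV (*) (\<lambda>a1 a2 a3. \<phi> (ten a1 b1) (ten a2 b2) (ten a3 b3))"
  unfolding trilin_on_def lin_on_def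
  by (simp add: ten_simps ten_L trilin_onD[OF assms(1)] assms(2-))

text \<open>Evaluating a product of tensors means evaluating the first factor at a form which is built from the
  second. That this form is bilinear is seen from a representation of the second factor as a finite
  sum.\<close>

private lemma bullet_eval:
  assumes T: "T \<in> tensor_space sB G sB G G G" and \<phi>: "bilin_on fscale L fscale L (*) \<phi>"
  shows "bullet sA sB B (\<Sum>i\<in>I. tensor sA UNIV sA UNIV (x i) (y i)) T \<phi> =
    (\<Sum>i\<in>I. T (\<lambda>b1 b2. \<phi> (ten (x i) b1) (ten (y i) b2)))"
proof -
  obtain n :: nat and u v where T': "T = (\<Sum>j<n. tensor sB G sB G (u j) (v j))"
    "\<And>j. j < n \<Longrightarrow> u j \<in> G" "\<And>j. j < n \<Longrightarrow> v j \<in> G"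
    by (rule tensor_space_representation[OF T B.vector_space_axioms sub(2) order_refl order_refl]) blast
  have "bilin_on sA UNIV sA UNIV (*) (\<lambda>a1 a2. \<Sum>j<n. \<phi> (ten a1 (u j)) (ten a2 (v j)))"
    by (rule bilin_on_sum) (use T'(2,3) in \<open>auto intro!: form2_A \<phi>\<close>)
  then show ?thesis
    by (simp add: bullet_def Let_def \<phi> T'(1) tensor_sum_apply form2_B)
qed

private lemma bullet3_eval:
  assumes T: "T \<in> tensor3_space sB G" and \<phi>: "trilin_on fscale L (*) \<phi>"
  shows "bullet3 sA sB B (\<Sum>i\<in>I. tensor3 sA UNIV (x i) (y i) (z i)) T \<phi> =
    (\<Sum>i\<in>I. T (\<lambda>b1 b2 b3. \<phi> (ten (x i) b1) (ten (y i) b2) (ten (z i) b3)))"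
proof -
  obtain n :: nat and u v w where T': "T = (\<Sum>j<n. tensor3 sB G (u j) (v j) (w j))"
    "\<And>j. j < n \<Longrightarrow> u j \<in> G" "\<And>j. j < n \<Longrightarrow> v j \<in> G" "\<And>j. j < n \<Longrightarrow> w j \<in> G"
    by (rule tensor3_space_representation[OF T B.vector_space_axioms sub(2)]) blast
  have "trilin_on sA UNIV (*) (\<lambda>a1 a2 a3. \<Sum>j<n. \<phi> (ten a1 (u j)) (ten a2 (v j)) (ten a3 (w j)))"
    by (rule trilin_on_sum) (use T'(2-) in \<open>auto intro!: form3_A \<phi>\<close>)
  then show ?thesis
    by (simp add: bullet3_def Let_def \<phi> T'(1) tensor3_sum_apply form3_B)
qed

private lemma bullet_sum:
  assumes "\<And>j. j \<in> J \<Longrightarrow> u j \<in> G" "\<And>j. j \<in> J \<Longrightarrow> v j \<in> G"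
  shows "bullet sA sB B (\<Sum>i\<in>I. tensor sA UNIV sA UNIV (x i) (y i)) (\<Sum>j\<in>J. tensor sB G sB G (u j) (v j))
    = (\<Sum>i\<in>I. \<Sum>j\<in>J. tensor fscale L fscale L (ten (x i) (u j)) (ten (y i) (v j)))" (is "?l = ?r")
proof (rule ext)
  fix \<phi>
  have T: "(\<Sum>j\<in>J. tensor sB G sB G (u j) (v j)) \<in> tensor_space sB G sB G G G"
    by (intro fs.subspace_sum[OF subspace_tensor_space] tensor_spaceI assms)
  show "?l \<phi> = ?r \<phi>"
  proof (cases "bilin_on fscale L fscale L (*) \<phi>")
    case True
    have "?l \<phi> = (\<Sum>i\<in>I. \<Sum>j\<in>J. \<phi> (ten (x i) (u j)) (ten (y i) (v j)))"
      by (simp add: bullet_eval[OF T True] tensor_sum_apply form2_B[OF True])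
    also have "\<dots> = ?r \<phi>"
      by (simp add: sum_fun_apply tensor_def[of fscale L] True)
    finally show ?thesis .
  qed (simp add: bullet_def sum_fun_apply tensor_def[of fscale])
qed

private lemma bullet3_sum:
  assumes "\<And>j. j \<in> J \<Longrightarrow> u j \<in> G" "\<And>j. j \<in> J \<Longrightarrow> v j \<in> G" "\<And>j. j \<in> J \<Longrightarrow> w j \<in> G"
  shows "bullet3 sA sB B (\<Sum>i\<in>I. tensor3 sA UNIV (x i) (y i) (z i)) (\<Sum>j\<in>J. tensor3 sB G (u j) (v j) (w j))
    = (\<Sum>i\<in>I. \<Sum>j\<in>J. tensor3 fscale L (ten (x i) (u j)) (ten (y i) (v j)) (ten (z i) (w j)))" (is "?l = ?r")
proof (rule ext)
  fix \<phi>
  have T: "(\<Sum>j\<in>J. tensor3 sB G (u j) (v j) (w j)) \<in> tensor3_space sB G"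
    by (intro fs.subspace_sum[OF subspace_tensor3_space] tensor3_spaceI assms)
  show "?l \<phi> = ?r \<phi>"
  proof (cases "trilin_on fscale L (*) \<phi>")
    case True
    have "?l \<phi> = (\<Sum>i\<in>I. \<Sum>j\<in>J. \<phi> (ten (x i) (u j)) (ten (y i) (v j)) (ten (z i) (w j)))"
      by (simp add: bullet3_eval[OF T True] tensor3_sum_apply form3_B[OF True])
    also have "\<dots> = ?r \<phi>"
      by (simp add: sum_fun_apply tensor3_def[of fscale L] True)
    finally show ?thesis .
  qed (simp add: bullet3_def sum_fun_apply tensor3_def[of fscale])
qed

text \<open>Additivity in the second factor holds only on the tensor product, not for arbitrary functionals: the
  first factor has to be linear on trilinear forms.\<close>

lemma
  assumes S: "S \<in> tensor3_space sA UNIV"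
  shows bullet3_0_right: "bullet3 sA sB B S 0 = 0"
    and bullet3_add_right: "T \<in> tensor3_space sB G \<Longrightarrow> T' \<in> tensor3_space sB G \<Longrightarrow>
      bullet3 sA sB B S (T + T') = bullet3 sA sB B S T + bullet3 sA sB B S T'"
    and bullet3_diff_right: "T \<in> tensor3_space sB G \<Longrightarrow> T' \<in> tensor3_space sB G \<Longrightarrow>
      bullet3 sA sB B S (T - T') = bullet3 sA sB B S T - bullet3 sA sB B S T'"
    and bullet3_fscale_right: "T \<in> tensor3_space sB G \<Longrightarrow>
      bullet3 sA sB B S (fscale c T) = fscale c (bullet3 sA sB B S T)"
proof -
  obtain n :: nat and u v w where S': "S = (\<Sum>j<n. tensor3 sA UNIV (u j) (v j) (w j))"
    by (rule tensor3_space_representation[OF S sA sub(1)])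
  note E = bullet3_eval[where I = "{..<n}" and x = u and y = v and z = w, folded S']
  note T3 = fs.subspace_add[OF subspace_tensor3_space] fs.subspace_diff[OF subspace_tensor3_space]
    fs.subspace_0[OF subspace_tensor3_space] fs.subspace_scale[OF subspace_tensor3_space]
  have out: "bullet3 sA sB B S T \<phi> = 0" if "\<not> trilin_on fscale L (*) \<phi>" for T \<phi>
    using that by (simp add: bullet3_def)
  have "bullet3 sA sB B S 0 \<phi> = 0" for \<phi>
    by (cases "trilin_on fscale L (*) \<phi>") (simp_all add: E T3 out)
  then show "bullet3 sA sB B S 0 = 0" by (simp add: fun_eq_iff)
  assume T: "T \<in> tensor3_space sB G"
  have "bullet3 sA sB B S (fscale c T) \<phi> = c * bullet3 sA sB B S T \<phi>" for \<phi>
    by (cases "trilin_on fscale L (*) \<phi>") (simp_all add: E T3 T out sum_distrib_left fscale_apply)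
  then show "bullet3 sA sB B S (fscale c T) = fscale c (bullet3 sA sB B S T)"
    by (simp add: fun_eq_iff fscale_apply)
  assume T': "T' \<in> tensor3_space sB G"
  have "bullet3 sA sB B S (T + T') \<phi> = bullet3 sA sB B S T \<phi> + bullet3 sA sB B S T' \<phi>" for \<phi>
    by (cases "trilin_on fscale L (*) \<phi>") (simp_all add: E T3 T T' out sum.distrib)
  then show "bullet3 sA sB B S (T + T') = bullet3 sA sB B S T + bullet3 sA sB B S T'"
    by (simp add: fun_eq_iff)
  have "bullet3 sA sB B S (T - T') \<phi> = bullet3 sA sB B S T \<phi> - bullet3 sA sB B S T' \<phi>" for \<phi>
    by (cases "trilin_on fscale L (*) \<phi>") (simp_all add: E T3 T T' out sum_subtractf)
  then show "bullet3 sA sB B S (T - T') = bullet3 sA sB B S T - bullet3 sA sB B S T'"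
    by (simp add: fun_eq_iff)
qed

lemma bullet3_tensor3_apply:
  assumes "trilin_on fscale L (*) \<phi>"
  shows "bullet3 sA sB B S (tensor3 sB G b1 b2 b3) \<phi> =
    S (\<lambda>a1 a2 a3. \<phi> (ten a1 b1) (ten a2 b2) (ten a3 b3))"
  by (simp add: bullet3_def Let_def assms tensor3_def form3_B)

lemma bullet3_sum_right:
  assumes "S \<in> tensor3_space sA UNIV" and "finite J" "\<And>j. j \<in> J \<Longrightarrow> T j \<in> tensor3_space sB G"
  shows "bullet3 sA sB B S (\<Sum>j\<in>J. T j) = (\<Sum>j\<in>J. bullet3 sA sB B S (T j))"
  using assms(2,3)
proof (induction J)
  case (insert j J)
  then show ?case
    unfolding sum.insert[OF insert(1,2)]
    by (subst bullet3_add_right[OF assms(1)])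
      (simp_all add: fs.subspace_sum[OF subspace_tensor3_space])
qed (simp only: sum.empty bullet3_0_right[OF assms(1)])

lemma bilin_bullet:
  assumes f: "tensor_map sA UNIV f" and g: "tensor_map sB G g"
  shows "bilin_on sA UNIV sB G fscale (\<lambda>a b. bullet sA sB B (f a) (g b))"
  unfolding bilin_on_def lin_on_def
proof (intro conjI ballI allI)
  fix a a' b
  show "bullet sA sB B (f (a + a')) (g b) = bullet sA sB B (f a) (g b) + bullet sA sB B (f a') (g b)"
    by (rule ext) (simp add: bullet_def Let_def tensor_mapD(2)[OF f])
  show "bullet sA sB B (f (sA c a)) (g b) = fscale c (bullet sA sB B (f a) (g b))" for c
    by (rule ext) (simp add: bullet_def Let_def tensor_mapD(3)[OF f] fscale_def)
next
  fix a b assume b: "b \<in> G"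
  obtain n :: nat and x y where fa: "f a = (\<Sum>j<n. tensor sA UNIV sA UNIV (x j) (y j))"
    by (rule tensor_space_representation[OF tensor_mapD(1)[OF f UNIV_I] sA sub(1) order_refl order_refl])
  have out: "bullet sA sB B (f a) T \<phi> = 0" if "\<not> bilin_on fscale L fscale L (*) \<phi>" for T \<phi>
    using that by (simp add: bullet_def)
  note E = bullet_eval[where I = "{..<n}" and x = x and y = y, folded fa]
  note g_in = tensor_mapD(1)[OF g]
  show "bullet sA sB B (f a) (g (sB c b)) = fscale c (bullet sA sB B (f a) (g b))" for c
  proof (rule ext)
    fix \<phi>
    show "bullet sA sB B (f a) (g (sB c b)) \<phi> = fscale c (bullet sA sB B (f a) (g b)) \<phi>"
      unfolding tensor_mapD(3)[OF g b]
      using fs.subspace_scale[OF subspace_tensor_space g_in[OF b]] g_in[OF b]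
      by (cases "bilin_on fscale L fscale L (*) \<phi>")
        (simp_all add: E out sum_distrib_left fscale_apply)
  qed
  fix b' assume b': "b' \<in> G"
  show "bullet sA sB B (f a) (g (b + b')) = bullet sA sB B (f a) (g b) + bullet sA sB B (f a) (g b')"
  proof (rule ext)
    fix \<phi>
    show "bullet sA sB B (f a) (g (b + b')) \<phi> = (bullet sA sB B (f a) (g b) + bullet sA sB B (f a) (g b')) \<phi>"
      unfolding tensor_mapD(2)[OF g b b']
      using fs.subspace_add[OF subspace_tensor_space g_in[OF b] g_in[OF b']] g_in[OF b] g_in[OF b']
      by (cases "bilin_on fscale L fscale L (*) \<phi>") (simp_all add: E out sum.distrib)
  qed
qed

private lemma map_left_bullet_pure:
  assumes f: "tensor_map sA UNIV f" and g: "tensor_map sB G g" and h: "tensor_map fscale L h"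
    and hfg: "\<And>a b. b \<in> G \<Longrightarrow> h (ten a b) = bullet sA sB B (f a) (g b)"
    and b: "b1 \<in> G" "b2 \<in> G"
  shows "map_left fscale L h (tensor fscale L fscale L (ten a1 b1) (ten a2 b2)) =
    bullet3 sA sB B (map_left sA UNIV f (tensor sA UNIV sA UNIV a1 a2)) (map_left sB G g (tensor sB G sB G b1 b2))"
proof -
  obtain n :: nat and x y where fa: "f a1 = (\<Sum>i<n. tensor sA UNIV sA UNIV (x i) (y i))"
    by (rule tensor_space_representation[OF tensor_mapD(1)[OF f UNIV_I] sA sub(1) order_refl order_refl])
  obtain m :: nat and u v where gb: "g b1 = (\<Sum>j<m. tensor sB G sB G (u j) (v j))"
    "\<And>j. j < m \<Longrightarrow> u j \<in> G" "\<And>j. j < m \<Longrightarrow> v j \<in> G"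
    by (rule tensor_space_representation[OF tensor_mapD(1)[OF g b(1)] B.vector_space_axioms sub(2)
          order_refl order_refl]) (rule that)
  have uv: "\<And>j. j \<in> {..<m} \<Longrightarrow> u j \<in> G" "\<And>j. j \<in> {..<m} \<Longrightarrow> v j \<in> G" using gb(2,3) by auto
  have "h (ten a1 b1) = (\<Sum>i<n. \<Sum>j<m. tensor fscale L fscale L (ten (x i) (u j)) (ten (y i) (v j)))"
    unfolding hfg[OF b(1)] fa gb(1) by (rule bullet_sum[OF uv])
  also have "\<dots> = (\<Sum>z\<in>{..<n}\<times>{..<m}. tensor fscale L fscale L
      (ten (x (fst z)) (u (snd z))) (ten (y (fst z)) (v (snd z))))"
    by (subst sum_pairs) (rule refl)
  finally have hab: "h (ten a1 b1) = \<dots>" .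
  have "map_left fscale L h (tensor fscale L fscale L (ten a1 b1) (ten a2 b2)) =
      (\<Sum>z\<in>{..<n}\<times>{..<m}. tensor3 fscale L (ten (x (fst z)) (u (snd z))) (ten (y (fst z)) (v (snd z))) (ten a2 b2))"
  proof (rule map_left_tensor[where s = fscale and V = L and f = h and c = "ten a1 b1" and d = "ten a2 b2"
        and I = "{..<n} \<times> {..<m}" and x = "\<lambda>z. ten (x (fst z)) (u (snd z))"
        and y = "\<lambda>z. ten (y (fst z)) (v (snd z))"])
    show "h (ten a1 b1) = (\<Sum>z\<in>{..<n}\<times>{..<m}. tensor fscale L fscale L
      (ten (x (fst z)) (u (snd z))) (ten (y (fst z)) (v (snd z))))" by (rule hab)
    show "lin_on fscale L fscale h" using h by (simp add: tensor_map_def)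
    show "c \<in> L \<Longrightarrow> h c \<in> tensor_space fscale L fscale L L L" for c by (rule tensor_mapD(1)[OF h])
    show "z \<in> {..<n} \<times> {..<m} \<Longrightarrow> ten (x (fst z)) (u (snd z)) \<in> L"
      "z \<in> {..<n} \<times> {..<m} \<Longrightarrow> ten (y (fst z)) (v (snd z)) \<in> L" for z
      by (auto intro!: ten_L uv)
    show "ten a1 b1 \<in> L" "ten a2 b2 \<in> L" by (rule ten_L, rule b)+
  qed (rule vector_space_fscale, rule sub)
  also have "\<dots> = (\<Sum>i<n. \<Sum>j<m. tensor3 fscale L (ten (x i) (u j)) (ten (y i) (v j)) (ten a2 b2))"
    by (subst sum_pairs) (rule refl)
  also have "\<dots> = bullet3 sA sB B (\<Sum>i<n. tensor3 sA UNIV (x i) (y i) a2) (\<Sum>j<m. tensor3 sB G (u j) (v j) b2)"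
    by (rule bullet3_sum[where w = "\<lambda>_. b2" and z = "\<lambda>_. a2", symmetric]) (simp_all add: gb(2,3) b(2))
  finally have hsum: "map_left fscale L h (tensor fscale L fscale L (ten a1 b1) (ten a2 b2)) =
      bullet3 sA sB B (\<Sum>i<n. tensor3 sA UNIV (x i) (y i) a2) (\<Sum>j<m. tensor3 sB G (u j) (v j) b2)" .
  have fsum: "map_left sA UNIV f (tensor sA UNIV sA UNIV a1 a2) = (\<Sum>i<n. tensor3 sA UNIV (x i) (y i) a2)"
  proof (rule map_left_tensor[where s = sA and V = UNIV and f = f and c = a1 and I = "{..<n}" and x = x and y = y,
        OF _ _ _ _ fa])
    show "lin_on sA UNIV fscale f" using f by (simp add: tensor_map_def)
    show "f c \<in> tensor_space sA UNIV sA UNIV UNIV UNIV" for c by (rule tensor_mapD(1)[OF f UNIV_I])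
  qed (rule sA sub UNIV_I)+
  have gsum: "map_left sB G g (tensor sB G sB G b1 b2) = (\<Sum>j<m. tensor3 sB G (u j) (v j) b2)"
  proof (rule map_left_tensor[where s = sB and V = G and f = g and c = b1 and I = "{..<m}" and x = u and y = v,
        OF _ _ _ _ gb(1)])
    show "lin_on sB G fscale g" using g by (simp add: tensor_map_def)
    show "c \<in> G \<Longrightarrow> g c \<in> tensor_space sB G sB G G G" for c by (rule tensor_mapD(1)[OF g])
  qed (rule B.vector_space_axioms sub b | rule uv, assumption)+
  show ?thesis unfolding hsum fsum gsum ..
qed

text \<open>If \<open>h\<close> is given on \<open>A \<otimes> B\<close> by \<open>f\<close> and \<open>g\<close>, then applying \<open>h\<close> to the first factor applies \<open>f\<close> and
  \<open>g\<close> to the first factors. On pure tensors both sides are the same double sum.\<close>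

lemma map_left_bullet:
  assumes f: "tensor_map sA UNIV f" and g: "tensor_map sB G g" and h: "tensor_map fscale L h"
    and hfg: "\<And>a b. b \<in> G \<Longrightarrow> h (ten a b) = bullet sA sB B (f a) (g b)"
    and S: "S \<in> tensor_space sA UNIV sA UNIV UNIV UNIV" and T: "T \<in> tensor_space sB G sB G G G"
  shows "map_left fscale L h (bullet sA sB B S T) =
    bullet3 sA sB B (map_left sA UNIV f S) (map_left sB G g T)"
proof -
  obtain n :: nat and x y where S': "S = (\<Sum>i<n. tensor sA UNIV sA UNIV (x i) (y i))"
    by (rule tensor_space_representation[OF S sA sub(1) order_refl order_refl])
  obtain m :: nat and u v where T': "T = (\<Sum>j<m. tensor sB G sB G (u j) (v j))"
    "\<And>j. j < m \<Longrightarrow> u j \<in> G" "\<And>j. j < m \<Longrightarrow> v j \<in> G"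
    by (rule tensor_space_representation[OF T B.vector_space_axioms sub(2) order_refl order_refl]) blast
  have uv: "\<And>j. j \<in> {..<m} \<Longrightarrow> u j \<in> G" "\<And>j. j \<in> {..<m} \<Longrightarrow> v j \<in> G" using T'(2,3) by auto
  have "map_left fscale L h (bullet sA sB B S T) = (\<Sum>i<n. \<Sum>j<m.
      map_left fscale L h (tensor fscale L fscale L (ten (x i) (u j)) (ten (y i) (v j))))"
    unfolding S' T'(1) by (subst bullet_sum[OF uv]) (simp_all only: map_left_sum)
  also have "\<dots> = (\<Sum>i<n. \<Sum>j<m. bullet3 sA sB B (map_left sA UNIV f (tensor sA UNIV sA UNIV (x i) (y i)))
      (map_left sB G g (tensor sB G sB G (u j) (v j))))"
    by (intro sum.cong refl map_left_bullet_pure f g h hfg uv)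
  also have "\<dots> = (\<Sum>i<n. bullet3 sA sB B (map_left sA UNIV f (tensor sA UNIV sA UNIV (x i) (y i)))
      (map_left sB G g T))"
    unfolding T'(1) map_left_sum
    by (intro sum.cong refl bullet3_sum_right[symmetric] map_left_pure(2)
        f g sA sub B.vector_space_axioms uv) auto
  also have "\<dots> = bullet3 sA sB B (map_left sA UNIV f S) (map_left sB G g T)"
    unfolding S' map_left_sum bullet3_sum_left ..
  finally show ?thesis .
qed

text \<open>Both sides are conjugate under the flip to those of the rule for the first factor.\<close>

lemma map_right_bullet:
  assumes "tensor_map sA UNIV f" and "tensor_map sB G g" and "tensor_map fscale L h"
    and "\<And>a b. b \<in> G \<Longrightarrow> h (ten a b) = bullet sA sB B (f a) (g b)"
    and S: "S \<in> tensor_space sA UNIV sA UNIV UNIV UNIV" and T: "T \<in> tensor_space sB G sB G G G"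
  shows "map_right fscale L h (bullet sA sB B S T) =
    bullet3 sA sB B (map_right sA UNIV f S) (map_right sB G g T)"
  unfolding map_right_eq_map_left flip_bullet flip12_bullet3[symmetric] flip23_bullet3[symmetric]
  by (subst map_left_bullet[OF assms(1-4) flip_tensor_space[OF S] flip_tensor_space[OF T]]) (assumption, rule refl)

private lemma bullet_homogeneous:
  assumes S: "S \<in> tensor_space sA UNIV sA UNIV UNIV UNIV" and T: "T \<in> tensor_space sB G sB G (B p) (B q)"
  shows "bullet sA sB B S T \<in> tensor_space fscale L fscale L (tensor_grading sA sB B p) (tensor_grading sA sB B q)"
proof -
  have BG: "B i \<subseteq> G" for i unfolding gspace_def by (auto intro: B.span_base)
  have Bsub: "B.subspace (B i)" for i using gB by (simp add: graded_space_def)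
  obtain n :: nat and x y where S': "S = (\<Sum>i<n. tensor sA UNIV sA UNIV (x i) (y i))"
    by (rule tensor_space_representation[OF S sA sub(1) order_refl order_refl])
  obtain m :: nat and u v where T': "T = (\<Sum>j<m. tensor sB G sB G (u j) (v j))"
    "\<And>j. j < m \<Longrightarrow> u j \<in> B p" "\<And>j. j < m \<Longrightarrow> v j \<in> B q"
    by (rule tensor_space_representation[OF T B.vector_space_axioms Bsub BG BG]) blast
  then have uv: "\<And>j. j \<in> {..<m} \<Longrightarrow> u j \<in> G" "\<And>j. j \<in> {..<m} \<Longrightarrow> v j \<in> G" using BG by auto
  have "bullet sA sB B S T = (\<Sum>i<n. \<Sum>j<m. tensor fscale L fscale L (ten (x i) (u j)) (ten (y i) (v j)))"
    unfolding S' T'(1) by (rule bullet_sum[OF uv])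
  also have "\<dots> \<in> tensor_space fscale L fscale L (tensor_grading sA sB B p) (tensor_grading sA sB B q)"
    unfolding tensor_grading_def[of _ _ _ p] tensor_grading_def[of _ _ _ q]
    by (intro fs.subspace_sum[OF subspace_tensor_space] tensor_spaceI T'(2,3) UNIV_I) simp_all
  finally show ?thesis .
qed

text \<open>The map on \<open>A \<otimes> B\<close> that is given by \<open>f\<close> and \<open>g\<close>, by the universal property.\<close>

lemma ex_bullet_map:
  assumes f: "tensor_map sA UNIV f" and g: "tensor_map sB G g"
    and gpq: "\<And>b. b \<in> G \<Longrightarrow> g b \<in> tensor_space sB G sB G (B p) (B q)"
  obtains h where "tensor_map fscale L h"
    and "\<And>a b. b \<in> G \<Longrightarrow> h (ten a b) = bullet sA sB B (f a) (g b)"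
    and "\<And>x. x \<in> L \<Longrightarrow> h x \<in> tensor_space fscale L fscale L (tensor_grading sA sB B p) (tensor_grading sA sB B q)"
proof -
  have gr: "tensor_grading sA sB B i \<subseteq> L" for i
    unfolding gspace_def[of fscale] by (auto intro: fs.span_base)
  obtain h where lin: "lin_on fscale (tensor_space sA UNIV sB G UNIV G) fscale h"
    and h: "\<forall>a\<in>UNIV. \<forall>b\<in>G. h (ten a b) = bullet sA sB B (f a) (g b)"
    using tensor_universal[OF vector_space_fscale bilin_bullet[OF f g]] by blast
  have lin: "lin_on fscale L fscale h" using lin by (simp only: gspace_tensor_grading[OF sA gB])
  have hpq: "h x \<in> tensor_space fscale L fscale L (tensor_grading sA sB B p) (tensor_grading sA sB B q)"
    if "x \<in> L" for x
    using that[unfolded gspace_tensor_grading[OF sA gB]] sA sub(1) order_refl order_refl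
  proof (rule tensor_space_induct)
    have "h (fscale 0 0) = fscale 0 (h 0)" using lin fs.subspace_0[OF sub(3)] unfolding lin_on_def by blast
    then have "h 0 = 0" by (simp only: fs.scale_zero_left)
    then show "h 0 \<in> tensor_space fscale L fscale L (tensor_grading sA sB B p) (tensor_grading sA sB B q)"
      by (simp only: fs.subspace_0[OF subspace_tensor_space])
  next
    fix a b x assume b: "b \<in> G" and x: "x \<in> tensor_space sA UNIV sB G UNIV G"
      and hx: "h x \<in> tensor_space fscale L fscale L (tensor_grading sA sB B p) (tensor_grading sA sB B q)"
    have "\<forall>x\<in>L. \<forall>y\<in>L. h (x + y) = h x + h y" using lin unfolding lin_on_def by blast
    moreover have "x \<in> L" using x by (simp only: gspace_tensor_grading[OF sA gB])
    ultimately have "h (ten a b + x) = bullet sA sB B (f a) (g b) + h x"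
      using h ten_L[OF b] b by simp
    then show "h (ten a b + x) \<in> tensor_space fscale L fscale L (tensor_grading sA sB B p) (tensor_grading sA sB B q)"
      using fs.subspace_add[OF subspace_tensor_space bullet_homogeneous[OF tensor_mapD(1)[OF f UNIV_I] gpq[OF b]] hx]
      by (simp only:)
  qed
  have "tensor_map fscale L h"
    unfolding tensor_map_def using lin hpq tensor_space_mono[OF gr gr] by blast
  then show thesis using h hpq by (intro that) auto
qed

text \<open>If a sum of homogeneous elements vanishes, evaluating it at the form \<open>\<phi>(a, \<pi>\<^sub>i b)\<close> isolates the
  value at \<open>\<phi>\<close> of the summand of degree \<open>i\<close>.\<close>

lemma graded_space_tensor_grading: "graded_space fscale (tensor_grading sA sB B)"
  unfolding graded_space_def
proof (intro conjI allI impI ballI vector_space_fscale)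
  show "fs.subspace (tensor_grading sA sB B i)" for i
    unfolding tensor_grading_def by (rule subspace_tensor_space)
next
  fix I x i
  assume I: "finite I" "i \<in> I" and x: "\<forall>i\<in>I. x i \<in> tensor_grading sA sB B i" and sum0: "(\<Sum>i\<in>I. x i) = 0"
  have BG: "B i \<subseteq> G" for i unfolding gspace_def by (auto intro: B.span_base)
  have Bsub: "B.subspace (B i)" for i using gB by (simp add: graded_space_def)
  obtain \<pi> where \<pi>_lin: "\<And>i. lin_on sB G sB (\<pi> i)"
    and \<pi>_in: "\<And>i b. b \<in> G \<Longrightarrow> \<pi> i b \<in> B i" and \<pi>_same: "\<And>i b. b \<in> B i \<Longrightarrow> \<pi> i b = b"
    and \<pi>_other: "\<And>i j b. b \<in> B j \<Longrightarrow> i \<noteq> j \<Longrightarrow> \<pi> i b = 0"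
    by (rule graded_projections[OF gB]) (rule that)
  have \<pi>_G: "\<pi> i b \<in> G" if "b \<in> G" for i b
    using \<pi>_in[OF that] BG by blast
  have "x i \<phi> = 0" for \<phi>
  proof (cases "bilin_on sA UNIV sB G (*) \<phi>")
    case \<phi>: True
    have \<phi>0: "\<phi> a 0 = 0" for a
      using bilin_onD(4)[OF \<phi> UNIV_I B.subspace_0[OF sub(2)], of a 0] by (simp only: B.scale_zero_left mult_zero_left)
    \<comment> \<open>The form that isolates degree \<open>i\<close>.\<close>
    have \<phi>': "bilin_on sA UNIV sB G (*) (\<lambda>a b. \<phi> a (\<pi> i b))"
      using \<pi>_lin[of i] \<phi> \<pi>_G unfolding bilin_on_def lin_on_def by simp
    have xj: "x j (\<lambda>a b. \<phi> a (\<pi> i b)) = (if j = i then x i \<phi> else 0)" if "j \<in> I" for j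
    proof -
      have "x j \<in> tensor_space sA UNIV sB G UNIV (B j)"
        using x that by (simp add: tensor_grading_def)
      then obtain n :: nat and u v where xj: "x j = (\<Sum>k<n. ten (u k) (v k))" and v: "\<And>k. k < n \<Longrightarrow> v k \<in> B j"
        by (rule tensor_space_representation[OF _ sA sub(1) order_refl BG]) (rule that)
      have \<phi>j: "x j (\<lambda>a b. \<phi> a (\<pi> i b)) = (\<Sum>k<n. \<phi> (u k) (\<pi> i (v k)))"
        by (simp only: xj tensor_sum_apply[OF \<phi>'])
      show ?thesis
      proof (cases "j = i")
        case True
        have "x j \<phi> = (\<Sum>k<n. \<phi> (u k) (v k))"
          by (simp only: xj tensor_sum_apply[OF \<phi>])
        with \<phi>j v True show ?thesis by (simp add: \<pi>_same)
      next
        case False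
        with \<phi>j v \<pi>_other[of _ j i] show ?thesis by (simp add: \<phi>0)
      qed
    qed
    have "0 = (\<Sum>j\<in>I. x j) (\<lambda>a b. \<phi> a (\<pi> i b))" by (simp only: sum0 zero_fun_apply)
    also have "\<dots> = x i \<phi>" using I by (simp add: sum_fun_apply xj)
    finally show ?thesis by simp
  next
    case False
    have "x i \<in> tensor_space sA UNIV sB G UNIV (B i)" using x I(2) by (simp add: tensor_grading_def)
    then show ?thesis using False by (rule tensor_space_eq_0_outside)
  qed
  then show "x i = 0" by (simp add: fun_eq_iff)
qed

section \<open>The induced cobracket\<close>

context
  fixes \<Delta>A :: "'a \<Rightarrow> ('k, 'a, 'a) tens" and \<Delta>B :: "'b \<Rightarrow> ('k, 'b) ctens"
    and \<delta> :: "('k, 'a, 'b) tens \<Rightarrow> ('k, ('k, 'a, 'b) tens) ctens"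
  assumes \<Delta>A: "comultiplication sA \<Delta>A" and \<Delta>B: "completed_comultiplication sB B \<Delta>B"
    and \<delta>: "induced_cobracket sA \<Delta>A sB B \<Delta>B \<delta>"
begin

private abbreviation (input) "Lg \<equiv> tensor_grading sA sB B"

private lemma Lg_sub: "Lg i \<subseteq> L"
  unfolding gspace_def[of fscale] by (auto intro: fs.span_base)

private lemma \<Delta>A_map: "tensor_map sA UNIV \<Delta>A"
  using \<Delta>A by (simp add: comultiplication_def tensor_map_def)

private lemma \<Delta>B_homogeneous: "b \<in> G \<Longrightarrow> \<Delta>B b p q \<in> tensor_space sB G sB G (B p) (B q)"
  using \<Delta>B by (auto simp: completed_comultiplication_def ctensor_space_def)

private lemma \<Delta>B_map: "tensor_map sB G (\<lambda>b. \<Delta>B b p q)"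
  unfolding tensor_map_def lin_on_def
proof (intro conjI ballI allI)
  have BG: "B i \<subseteq> G" for i unfolding gspace_def by (auto intro: B.span_base)
  fix b assume b: "b \<in> G"
  show "\<Delta>B b p q \<in> tensor_space sB G sB G G G"
    using \<Delta>B_homogeneous[OF b] tensor_space_mono[OF BG BG] by blast
  show "\<Delta>B (sB c b) p q = fscale c (\<Delta>B b p q)" for c
    using \<Delta>B b by (simp add: completed_comultiplication_def lin_on_def cscale_def)
  show "\<Delta>B (b + b') p q = \<Delta>B b p q + \<Delta>B b' p q" if "b' \<in> G" for b'
    using \<Delta>B b that by (simp add: completed_comultiplication_def lin_on_def)
qed

private lemma \<delta>_lin: "x \<in> L \<Longrightarrow> y \<in> L \<Longrightarrow> \<delta> (x + y) = \<delta> x + \<delta> y" "x \<in> L \<Longrightarrow> \<delta> (fscale c x) = cscale c (\<delta> x)"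
  using \<delta> unfolding induced_cobracket_def lin_on_def by blast+

private lemma \<delta>_0: "\<delta> 0 = 0"
  using \<delta>_lin(1)[OF fs.subspace_0[OF sub(3)] fs.subspace_0[OF sub(3)]] by simp

private lemma \<delta>_ten: "b \<in> G \<Longrightarrow> \<delta> (ten a b) p q =
    bullet sA sB B (\<Delta>A a) (\<Delta>B b p q) - flip (bullet sA sB B (\<Delta>A a) (\<Delta>B b q p))"
  using \<delta> by (simp add: induced_cobracket_def cbullet_def cflip_def)

private lemma L_induct:
  assumes x: "x \<in> L" and P: "P 0" "\<And>a b x. b \<in> G \<Longrightarrow> x \<in> L \<Longrightarrow> P x \<Longrightarrow> P (ten a b + x)"
  shows "P x"
proof (rule tensor_space_induct[where P = P and V = UNIV and V' = UNIV and W = G and W' = G])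
  show "x \<in> tensor_space sA UNIV sB G UNIV G" using x by (simp only: gspace_tensor_grading[OF sA gB])
  show "P (ten a b + y)" if "b \<in> G" "y \<in> tensor_space sA UNIV sB G UNIV G" "P y" for a b y
    using P(2)[OF that(1) _ that(3)] that(2) by (simp only: gspace_tensor_grading[OF sA gB])
qed (rule sA sub order_refl P)+

text \<open>Each bihomogeneous component of \<open>\<delta>\<close> is a difference of maps to which the rules for products of
  tensors apply. The components are chosen anew rather than taken from \<open>\<delta>\<close>, since a component of \<open>\<delta>\<close> is
  not itself given by a map on \<open>A\<close> and a map on \<open>B\<close>.\<close>

private lemma cobracket_components:
  obtains E where "\<And>p q. tensor_map fscale L (E p q)"
    and "\<And>p q a b. b \<in> G \<Longrightarrow> E p q (ten a b) = bullet sA sB B (\<Delta>A a) (\<Delta>B b p q)"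
    and "\<And>p q x. x \<in> L \<Longrightarrow> E p q x \<in> tensor_space fscale L fscale L (Lg p) (Lg q)"
    and "\<And>p q x. x \<in> L \<Longrightarrow> \<delta> x p q = E p q x - flip (E q p x)"
proof -
  let ?P = "\<lambda>p q h. tensor_map fscale L h \<and> (\<forall>a. \<forall>b\<in>G. h (ten a b) = bullet sA sB B (\<Delta>A a) (\<Delta>B b p q)) \<and>
    (\<forall>x\<in>L. h x \<in> tensor_space fscale L fscale L (Lg p) (Lg q))"
  define E where "E p q = (SOME h. ?P p q h)" for p q
  have "\<exists>h. ?P p q h" for p q
    by (rule ex_bullet_map[OF \<Delta>A_map \<Delta>B_map, of p q p q, OF \<Delta>B_homogeneous]) blast+
  then have "?P p q (E p q)" for p q
    unfolding E_def by (rule someI_ex)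
  then have E: "tensor_map fscale L (E p q)"
    "b \<in> G \<Longrightarrow> E p q (ten a b) = bullet sA sB B (\<Delta>A a) (\<Delta>B b p q)"
    "x \<in> L \<Longrightarrow> E p q x \<in> tensor_space fscale L fscale L (Lg p) (Lg q)" for p q a b x
    by blast+
  note E_add = tensor_mapD(2)[OF E(1)]
  have E0: "E p q 0 = 0" for p q
    using E_add[OF fs.subspace_0[OF sub(3)] fs.subspace_0[OF sub(3)]] by simp
  have "\<delta> x p q = E p q x - flip (E q p x)" if "x \<in> L" for p q x
    using that
  proof (rule L_induct)
    show "\<delta> 0 p q = E p q 0 - flip (E q p 0)"
      by (simp add: \<delta>_0 E0 flip_def fun_eq_iff)
  next
    fix a b x assume b: "b \<in> G" and x: "x \<in> L" and IH: "\<delta> x p q = E p q x - flip (E q p x)"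
    show "\<delta> (ten a b + x) p q = E p q (ten a b + x) - flip (E q p (ten a b + x))"
      by (simp only: \<delta>_lin(1)[OF ten_L[OF b] x] E_add[OF ten_L[OF b] x] plus_fun_apply \<delta>_ten[OF b] E(2)[OF b]
          IH flip_add add_diff_add)
  qed
  then show thesis using E by (intro that)
qed

lemma completed_comultiplication_cobracket: "completed_comultiplication fscale Lg \<delta>"
proof -
  obtain E where E: "\<And>p q. tensor_map fscale L (E p q)"
      "\<And>p q a b. b \<in> G \<Longrightarrow> E p q (ten a b) = bullet sA sB B (\<Delta>A a) (\<Delta>B b p q)"
      "\<And>p q x. x \<in> L \<Longrightarrow> E p q x \<in> tensor_space fscale L fscale L (Lg p) (Lg q)"
      "\<And>p q x. x \<in> L \<Longrightarrow> \<delta> x p q = E p q x - flip (E q p x)"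
    by (rule cobracket_components) (rule that)
  have "\<delta> x \<in> ctensor_space fscale Lg" if "x \<in> L" for x
    unfolding ctensor_space_def mem_Collect_eq E(4)[OF that]
    by (intro allI fs.subspace_diff[OF subspace_tensor_space] flip_tensor_space E(3) that)
  then show ?thesis
    using \<delta> by (auto simp: completed_comultiplication_def induced_cobracket_def)
qed

lemma cobracket_antisymmetric:
  assumes "x \<in> L"
  shows "\<delta> x = - cflip (\<delta> x)"
proof -
  obtain E where E: "\<And>p q. tensor_map fscale L (E p q)"
      "\<And>p q a b. b \<in> G \<Longrightarrow> E p q (ten a b) = bullet sA sB B (\<Delta>A a) (\<Delta>B b p q)"
      "\<And>p q x. x \<in> L \<Longrightarrow> E p q x \<in> tensor_space fscale L fscale L (Lg p) (Lg q)"
      "\<And>p q x. x \<in> L \<Longrightarrow> \<delta> x p q = E p q x - flip (E q p x)"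
    by (rule cobracket_components) (rule that)
  show ?thesis
    by (intro ext) (simp only: fun_Compl_def cflip_def E(4)[OF assms] flip_diff flip_flip, simp)
qed

text \<open>Expanding both \<open>\<delta>\<close> as \<open>(1 - \<tau>) (\<Delta> \<bullet> \<Delta>)\<close> gives four terms. The flip in the \<open>\<delta>\<close> that is applied last
  exchanges two of the degrees; the flip in the one that is applied first exchanges the roles of the two
  kinds of composite.\<close>

private lemma cobracket_terms:
  fixes a :: 'a
  assumes b: "b \<in> G"
  defines "Y \<equiv> \<lambda>p q r i. bullet3 sA sB B (map_left sA UNIV \<Delta>A (\<Delta>A a)) (cleft_term sB B \<Delta>B (\<Delta>B b) p q r i)"
    and "X \<equiv> \<lambda>p q r i. bullet3 sA sB B (map_right sA UNIV \<Delta>A (\<Delta>A a)) (cright_term sB B \<Delta>B (\<Delta>B b) p q r i)"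
  shows "cleft_term fscale Lg \<delta> (\<delta> (ten a b)) p q r i =
      Y p q r i - flip12 (Y q p r i) - flip23 (flip12 (X r p q i)) + flip12 (flip23 (flip12 (X r q p i)))"
    and "cright_term fscale Lg \<delta> (\<delta> (ten a b)) p q r i =
      X p q r i - flip23 (X p r q i) - flip12 (flip23 (Y q r p i)) + flip23 (flip12 (flip23 (Y r q p i)))"
proof -
  obtain E where E: "\<And>p q. tensor_map fscale L (E p q)"
      "\<And>p q a b. b \<in> G \<Longrightarrow> E p q (ten a b) = bullet sA sB B (\<Delta>A a) (\<Delta>B b p q)"
      "\<And>p q x. x \<in> L \<Longrightarrow> E p q x \<in> tensor_space fscale L fscale L (Lg p) (Lg q)"
      "\<And>p q x. x \<in> L \<Longrightarrow> \<delta> x p q = E p q x - flip (E q p x)"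
    by (rule cobracket_components) (rule that)
  let ?U = "\<lambda>p q. bullet sA sB B (\<Delta>A a) (\<Delta>B b p q)"
  have U: "?U p q \<in> tensor_space fscale L fscale L L L" for p q
    using subsetD[OF tensor_space_mono[OF Lg_sub Lg_sub] E(3)[OF ten_L[OF b, of a], of p q]]
    by (simp only: E(2)[OF b])
  have \<delta>U: "\<delta> (ten a b) p q \<in> tensor_space fscale L fscale L L L" for p q
    unfolding \<delta>_ten[OF b] by (intro fs.subspace_diff[OF subspace_tensor_space] flip_tensor_space U)
  have \<delta>_map: "tensor_map fscale L (\<lambda>c. \<delta> c p q)" for p q
    unfolding tensor_map_def lin_on_def
  proof (intro conjI ballI allI)
    fix c assume c: "c \<in> L"
    show "\<delta> c p q \<in> tensor_space fscale L fscale L L L"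
      unfolding E(4)[OF c] using E(3)[OF c] tensor_space_mono[OF Lg_sub Lg_sub]
      by (intro fs.subspace_diff[OF subspace_tensor_space] flip_tensor_space) blast+
    show "\<delta> (fscale k c) p q = fscale k (\<delta> c p q)" for k
      by (simp only: \<delta>_lin(2)[OF c] cscale_def)
    show "\<delta> (c + d) p q = \<delta> c p q + \<delta> d p q" if "d \<in> L" for d
      by (simp only: \<delta>_lin(1)[OF c that] plus_fun_apply)
  qed
  have Y: "map_left fscale L (E p q) (?U i r) = Y p q r i" for p q r i
    unfolding Y_def cleft_term_def
    by (rule map_left_bullet[OF \<Delta>A_map \<Delta>B_map E(1) E(2) tensor_mapD(1)[OF \<Delta>A_map UNIV_I] tensor_mapD(1)[OF \<Delta>B_map b]])
  have X: "map_right fscale L (E q r) (?U p i) = X p q r i" for p q r i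
    unfolding X_def cright_term_def
    by (rule map_right_bullet[OF \<Delta>A_map \<Delta>B_map E(1) E(2) tensor_mapD(1)[OF \<Delta>A_map UNIV_I] tensor_mapD(1)[OF \<Delta>B_map b]])
  have l: "map_left fscale L (\<lambda>c. \<delta> c p q) T = map_left fscale L (E p q) T - flip12 (map_left fscale L (E q p) T)"
    if "T \<in> tensor_space fscale L fscale L L L" for p q T
    by (subst map_left_flip_comp[symmetric],
        rule map_left_diff_fun[OF E(1) tensor_map_flip[OF E(1)] \<delta>_map E(4) that vector_space_fscale sub(3)])
  have r: "map_right fscale L (\<lambda>c. \<delta> c p q) T = map_right fscale L (E p q) T - flip23 (map_right fscale L (E q p) T)"
    if "T \<in> tensor_space fscale L fscale L L L" for p q T
    by (subst map_right_flip_comp[symmetric],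
        rule map_right_diff_fun[OF E(1) tensor_map_flip[OF E(1)] \<delta>_map E(4) that vector_space_fscale sub(3)])
  show "cleft_term fscale Lg \<delta> (\<delta> (ten a b)) p q r i =
      Y p q r i - flip12 (Y q p r i) - flip23 (flip12 (X r p q i)) + flip12 (flip23 (flip12 (X r q p i)))"
    unfolding cleft_term_def l[OF \<delta>U] unfolding \<delta>_ten[OF b] map_left_diff map_left_flip X Y flip12_diff
    by (simp only: algebra_simps)
  show "cright_term fscale Lg \<delta> (\<delta> (ten a b)) p q r i =
      X p q r i - flip23 (X p r q i) - flip12 (flip23 (Y q r p i)) + flip23 (flip12 (flip23 (Y r q p i)))"
    unfolding cright_term_def r[OF \<delta>U] unfolding \<delta>_ten[OF b] map_right_diff map_right_flip X Y flip23_diff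
    by (simp only: algebra_simps)
qed

private lemma
  fixes a :: 'a and p q r :: int
  assumes b: "b \<in> G" and F: "finite F"
  shows bullet3_cleft: "{i. cleft_term sB B \<Delta>B (\<Delta>B b) p q r i \<noteq> 0} \<subseteq> F \<Longrightarrow>
      bullet3 sA sB B (map_left sA UNIV \<Delta>A (\<Delta>A a)) (cleft sB B \<Delta>B (\<Delta>B b) p q r) =
      (\<Sum>i\<in>F. bullet3 sA sB B (map_left sA UNIV \<Delta>A (\<Delta>A a)) (cleft_term sB B \<Delta>B (\<Delta>B b) p q r i))"
    and bullet3_cright: "{i. cright_term sB B \<Delta>B (\<Delta>B b) p q r i \<noteq> 0} \<subseteq> F \<Longrightarrow>
      bullet3 sA sB B (map_right sA UNIV \<Delta>A (\<Delta>A a)) (cright sB B \<Delta>B (\<Delta>B b) p q r) =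
      (\<Sum>i\<in>F. bullet3 sA sB B (map_right sA UNIV \<Delta>A (\<Delta>A a)) (cright_term sB B \<Delta>B (\<Delta>B b) p q r i))"
proof -
  have "cleft_term sB B \<Delta>B (\<Delta>B b) p q r i \<in> tensor3_space sB G" for i
    unfolding cleft_term_def
    by (rule map_left_tensor3_space[OF \<Delta>B_map tensor_mapD(1)[OF \<Delta>B_map b] B.vector_space_axioms sub(2)])
  moreover assume "{i. cleft_term sB B \<Delta>B (\<Delta>B b) p q r i \<noteq> 0} \<subseteq> F"
  ultimately show "bullet3 sA sB B (map_left sA UNIV \<Delta>A (\<Delta>A a)) (cleft sB B \<Delta>B (\<Delta>B b) p q r) =
      (\<Sum>i\<in>F. bullet3 sA sB B (map_left sA UNIV \<Delta>A (\<Delta>A a)) (cleft_term sB B \<Delta>B (\<Delta>B b) p q r i))"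
    by (subst cleft_eq_sum[OF F])
      (assumption, intro bullet3_sum_right[OF map_left_tensor3_space[OF \<Delta>A_map tensor_mapD(1)[OF \<Delta>A_map UNIV_I] sA sub(1)] F])
next
  have "cright_term sB B \<Delta>B (\<Delta>B b) p q r i \<in> tensor3_space sB G" for i
    unfolding cright_term_def
    by (rule map_right_tensor3_space[OF \<Delta>B_map tensor_mapD(1)[OF \<Delta>B_map b] B.vector_space_axioms sub(2)])
  moreover assume "{i. cright_term sB B \<Delta>B (\<Delta>B b) p q r i \<noteq> 0} \<subseteq> F"
  ultimately show "bullet3 sA sB B (map_right sA UNIV \<Delta>A (\<Delta>A a)) (cright sB B \<Delta>B (\<Delta>B b) p q r) =
      (\<Sum>i\<in>F. bullet3 sA sB B (map_right sA UNIV \<Delta>A (\<Delta>A a)) (cright_term sB B \<Delta>B (\<Delta>B b) p q r i))"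
    by (subst cright_eq_sum[OF F])
      (assumption, intro bullet3_sum_right[OF map_right_tensor3_space[OF \<Delta>A_map tensor_mapD(1)[OF \<Delta>A_map UNIV_I] sA sub(1)] F])
qed

private lemma bullet3_A_0:
  "bullet3 sA sB B (map_left sA UNIV \<Delta>A (\<Delta>A a)) 0 = 0"
  "bullet3 sA sB B (map_right sA UNIV \<Delta>A (\<Delta>A a)) 0 = 0"
  by (intro bullet3_0_right map_left_tensor3_space map_right_tensor3_space \<Delta>A_map tensor_mapD(1)[OF \<Delta>A_map UNIV_I]
      sA sub(1))+

lemma cobracket_composites:
  fixes a :: 'a
  assumes b: "b \<in> G" and def_left: "cleft_defined sB B \<Delta>B (\<Delta>B b)" and def_right: "cright_defined sB B \<Delta>B (\<Delta>B b)"
  defines "Y \<equiv> \<lambda>p q r. bullet3 sA sB B (map_left sA UNIV \<Delta>A (\<Delta>A a)) (cleft sB B \<Delta>B (\<Delta>B b) p q r)"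
    and "X \<equiv> \<lambda>p q r. bullet3 sA sB B (map_right sA UNIV \<Delta>A (\<Delta>A a)) (cright sB B \<Delta>B (\<Delta>B b) p q r)"
  shows "cleft_defined fscale Lg \<delta> (\<delta> (ten a b))" and "cright_defined fscale Lg \<delta> (\<delta> (ten a b))"
    and "cleft fscale Lg \<delta> (\<delta> (ten a b)) = Y - cflip12 Y - cflip23 (cflip12 X) + cflip12 (cflip23 (cflip12 X))"
    and "cright fscale Lg \<delta> (\<delta> (ten a b)) = X - cflip23 X - cflip12 (cflip23 Y) + cflip23 (cflip12 (cflip23 Y))"
proof -
  let ?l = "\<lambda>p q r. {i. cleft_term sB B \<Delta>B (\<Delta>B b) p q r i \<noteq> 0}"
  let ?r = "\<lambda>p q r. {i. cright_term sB B \<Delta>B (\<Delta>B b) p q r i \<noteq> 0}"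
  \<comment> \<open>One finite set of indices outside of which all terms of the eight composites involved vanish.\<close>
  define F where "F p q r = ?l p q r \<union> ?l q p r \<union> ?l q r p \<union> ?l r q p \<union> ?r p q r \<union> ?r p r q \<union> ?r r p q \<union> ?r r q p"
    for p q r
  have fin: "finite (F p q r)" for p q r
    using def_left def_right unfolding F_def cleft_defined_def cright_defined_def by (intro finite_UnI) blast+
  have sub: "?l p q r \<subseteq> F p q r" "?l q p r \<subseteq> F p q r" "?l q r p \<subseteq> F p q r" "?l r q p \<subseteq> F p q r"
    "?r p q r \<subseteq> F p q r" "?r p r q \<subseteq> F p q r" "?r r p q \<subseteq> F p q r" "?r r q p \<subseteq> F p q r" for p q r
    unfolding F_def by blast+
  have "cleft_term fscale Lg \<delta> (\<delta> (ten a b)) p q r i = 0" if "i \<notin> F p q r" for p q r i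
  proof -
    have 0: "cleft_term sB B \<Delta>B (\<Delta>B b) p q r i = 0" "cleft_term sB B \<Delta>B (\<Delta>B b) q p r i = 0"
      "cright_term sB B \<Delta>B (\<Delta>B b) r p q i = 0" "cright_term sB B \<Delta>B (\<Delta>B b) r q p i = 0"
      using that unfolding F_def by blast+
    show ?thesis
      unfolding cobracket_terms(1)[OF b] 0 bullet3_A_0 flip12_0 flip23_0 by (simp only: diff_0_right add_0_right)
  qed
  then have sub_l: "{i. cleft_term fscale Lg \<delta> (\<delta> (ten a b)) p q r i \<noteq> 0} \<subseteq> F p q r" for p q r by blast
  have "cright_term fscale Lg \<delta> (\<delta> (ten a b)) p q r i = 0" if "i \<notin> F p q r" for p q r i
  proof -
    have 0: "cright_term sB B \<Delta>B (\<Delta>B b) p q r i = 0" "cright_term sB B \<Delta>B (\<Delta>B b) p r q i = 0"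
      "cleft_term sB B \<Delta>B (\<Delta>B b) q r p i = 0" "cleft_term sB B \<Delta>B (\<Delta>B b) r q p i = 0"
      using that unfolding F_def by blast+
    show ?thesis
      unfolding cobracket_terms(2)[OF b] 0 bullet3_A_0 flip12_0 flip23_0 by (simp only: diff_0_right add_0_right)
  qed
  then have sub_r: "{i. cright_term fscale Lg \<delta> (\<delta> (ten a b)) p q r i \<noteq> 0} \<subseteq> F p q r" for p q r by blast
  show "cleft_defined fscale Lg \<delta> (\<delta> (ten a b))" "cright_defined fscale Lg \<delta> (\<delta> (ten a b))"
    unfolding cleft_defined_def cright_defined_def
    using finite_subset[OF sub_l fin] finite_subset[OF sub_r fin] by blast+
  have Y: "?l p q r \<subseteq> F p' q' r' \<Longrightarrow> Y p q r = (\<Sum>i\<in>F p' q' r'.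
      bullet3 sA sB B (map_left sA UNIV \<Delta>A (\<Delta>A a)) (cleft_term sB B \<Delta>B (\<Delta>B b) p q r i))" for p q r p' q' r'
    unfolding Y_def by (rule bullet3_cleft[OF b fin])
  have X: "?r p q r \<subseteq> F p' q' r' \<Longrightarrow> X p q r = (\<Sum>i\<in>F p' q' r'.
      bullet3 sA sB B (map_right sA UNIV \<Delta>A (\<Delta>A a)) (cright_term sB B \<Delta>B (\<Delta>B b) p q r i))" for p q r p' q' r'
    unfolding X_def by (rule bullet3_cright[OF b fin])
  have "cleft fscale Lg \<delta> (\<delta> (ten a b)) p q r =
      Y p q r - flip12 (Y q p r) - flip23 (flip12 (X r p q)) + flip12 (flip23 (flip12 (X r q p)))" for p q r
    by (simp only: cleft_eq_sum[OF fin sub_l] cobracket_terms(1)[OF b] Y[OF sub(1)[where p = p and q = q and r = r]] Y[OF sub(2)[where p = p and q = q and r = r]] X[OF sub(7)[where p = p and q = q and r = r]] X[OF sub(8)[where p = p and q = q and r = r]]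
        flip12_sum flip23_sum sum.distrib sum_subtractf)
  then show "cleft fscale Lg \<delta> (\<delta> (ten a b)) = Y - cflip12 Y - cflip23 (cflip12 X) + cflip12 (cflip23 (cflip12 X))"
    by (intro ext) (simp only: cflip12_def cflip23_def plus_fun_apply minus_apply)
  have "cright fscale Lg \<delta> (\<delta> (ten a b)) p q r =
      X p q r - flip23 (X p r q) - flip12 (flip23 (Y q r p)) + flip23 (flip12 (flip23 (Y r q p)))" for p q r
    by (simp only: cright_eq_sum[OF fin sub_r] cobracket_terms(2)[OF b] X[OF sub(5)[where p = p and q = q and r = r]] X[OF sub(6)[where p = p and q = q and r = r]] Y[OF sub(3)[where p = p and q = q and r = r]] Y[OF sub(4)[where p = p and q = q and r = r]]
        flip12_sum flip23_sum sum.distrib sum_subtractf)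
  then show "cright fscale Lg \<delta> (\<delta> (ten a b)) = X - cflip23 X - cflip12 (cflip23 Y) + cflip23 (cflip12 (cflip23 Y))"
    by (intro ext) (simp only: cflip12_def cflip23_def plus_fun_apply minus_apply)
qed

text \<open>The composites are additive, and \<open>A \<otimes> B\<close> consists of sums of pure tensors.\<close>

lemma completed_lie_coalgebra_cobracketI:
  assumes defined: "\<And>b. b \<in> G \<Longrightarrow> cleft_defined sB B \<Delta>B (\<Delta>B b)" "\<And>b. b \<in> G \<Longrightarrow> cright_defined sB B \<Delta>B (\<Delta>B b)"
    and pure: "\<And>a b. b \<in> G \<Longrightarrow> cright fscale Lg \<delta> (\<delta> (ten a b)) - cflip12 (cright fscale Lg \<delta> (\<delta> (ten a b))) =
      cleft fscale Lg \<delta> (\<delta> (ten a b))"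
  shows "completed_lie_coalgebra fscale Lg \<delta>"
proof -
  let ?good = "\<lambda>u. cleft_defined fscale Lg \<delta> u \<and> cright_defined fscale Lg \<delta> u \<and>
    cright fscale Lg \<delta> u - cflip12 (cright fscale Lg \<delta> u) = cleft fscale Lg \<delta> u"
  have "?good (\<delta> x)" if "x \<in> L" for x
  proof (rule L_induct[where P = "\<lambda>x. ?good (\<delta> x)", OF that])
    show "?good (\<delta> 0)"
      unfolding \<delta>_0 by (simp only: cleft_0 cright_0 cflip12_0 diff_0_right simp_thms)
  next
    fix a b x assume b: "b \<in> G" and x: "x \<in> L" and IH: "?good (\<delta> x)"
    note c = cobracket_composites(1,2)[OF b defined(1)[OF b] defined(2)[OF b], of a]
    have "cright fscale Lg \<delta> (\<delta> (ten a b) + \<delta> x) - cflip12 (cright fscale Lg \<delta> (\<delta> (ten a b) + \<delta> x)) =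
        (cright fscale Lg \<delta> (\<delta> (ten a b)) - cflip12 (cright fscale Lg \<delta> (\<delta> (ten a b)))) +
        (cright fscale Lg \<delta> (\<delta> x) - cflip12 (cright fscale Lg \<delta> (\<delta> x)))"
      using IH c by (simp only: cright_add(2) cflip12_add add_diff_add)
    also have "\<dots> = cleft fscale Lg \<delta> (\<delta> (ten a b) + \<delta> x)"
      using IH c by (simp only: pure[OF b] cleft_add(2))
    finally show "?good (\<delta> (ten a b + x))"
      using IH c cleft_add(1) cright_add(1) unfolding \<delta>_lin(1)[OF ten_L[OF b] x] by blast
  qed
  then show ?thesis
    unfolding completed_lie_coalgebra_def
    using graded_space_tensor_grading completed_comultiplication_cobracket cobracket_antisymmetric by blast
qed

text \<open>Comparison with \<open>Z = L \<bullet> \<rho>\<close>: the symmetry \<open>s \<rho> = \<rho>\<close> lets the Novikov axiom for \<open>R - s R\<close> be applied in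
  the factor \<open>A\<close>, and the symmetry \<open>t L = L\<close> lets the right Novikov axiom for \<open>\<lambda> - t \<lambda>\<close> be applied in
  the factor \<open>B\<close>.\<close>

lemma completed_lie_coalgebra_cobracket:
  assumes A: "novikov_coalgebra sA \<Delta>A" and B: "completed_right_novikov_coalgebra sB B \<Delta>B"
  shows "completed_lie_coalgebra fscale Lg \<delta>"
proof (rule completed_lie_coalgebra_cobracketI)
  show defined: "cleft_defined sB B \<Delta>B (\<Delta>B b)" "cright_defined sB B \<Delta>B (\<Delta>B b)" if "b \<in> G" for b
    using B that by (auto simp: completed_right_novikov_coalgebra_def)
  fix a b assume b: "b \<in> G"
  let ?R = "map_right sA UNIV \<Delta>A (\<Delta>A a)" and ?L = "map_left sA UNIV \<Delta>A (\<Delta>A a)"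
    and ?\<rho> = "cright sB B \<Delta>B (\<Delta>B b)" and ?\<Lambda> = "cleft sB B \<Delta>B (\<Delta>B b)"
  let ?W = "\<lambda>S w p q r. bullet3 sA sB B S (w p q r)"
  note A' = A[unfolded novikov_coalgebra_def map_right_flip flip12_flip12, THEN conjunct2, THEN conjunct2,
      THEN spec[of _ a]]
  have A1: "?R - flip12 ?R = ?L - flip12 ?L" and A2: "flip23 ?L = ?L"
    by (rule A'[THEN conjunct1], rule A'[THEN conjunct2])
  note B' = bspec[OF B[unfolded completed_right_novikov_coalgebra_def, THEN conjunct2, THEN conjunct2] b,
      THEN conjunct2, THEN conjunct2]
  have B1: "?\<Lambda> - cflip23 ?\<Lambda> = ?\<rho> - cflip23 ?\<rho>" and B2: "cflip12 ?\<rho> = ?\<rho>"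
    by (rule B'[THEN conjunct1], rule B'[THEN conjunct2, symmetric])
  have L: "?L \<in> tensor3_space sA UNIV"
    by (rule map_left_tensor3_space[OF \<Delta>A_map tensor_mapD(1)[OF \<Delta>A_map UNIV_I] sA sub(1)])
  have \<Lambda>: "?\<Lambda> p q r \<in> tensor3_space sB G" for p q r
    unfolding cleft_def cleft_term_def
    by (intro fs.subspace_sum[OF subspace_tensor3_space]
        map_left_tensor3_space[OF \<Delta>B_map tensor_mapD(1)[OF \<Delta>B_map b] B.vector_space_axioms sub(2)])
  have \<rho>: "?\<rho> p q r \<in> tensor3_space sB G" for p q r
    unfolding cright_def cright_term_def
    by (intro fs.subspace_sum[OF subspace_tensor3_space]
        map_right_tensor3_space[OF \<Delta>B_map tensor_mapD(1)[OF \<Delta>B_map b] B.vector_space_axioms sub(2)])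
  have W_diff: "?W ?L v - ?W ?L w = ?W ?L (v - w)"
    if "\<And>p q r. v p q r \<in> tensor3_space sB G" "\<And>p q r. w p q r \<in> tensor3_space sB G" for v w
    by (intro ext) (simp only: bullet3_diff_right[OF L that] minus_apply)
  have "?W ?R ?\<rho> - cflip12 (?W ?R ?\<rho>) = ?W (?R - flip12 ?R) ?\<rho>"
    unfolding cflip12_bullet3 B2 by (intro ext) (simp only: bullet3_diff_left minus_apply)
  also have "\<dots> = ?W ?L ?\<rho> - cflip12 (?W ?L ?\<rho>)"
    unfolding cflip12_bullet3 B2 A1 by (intro ext) (simp only: bullet3_diff_left minus_apply)
  finally have X: "?W ?R ?\<rho> - cflip12 (?W ?R ?\<rho>) = ?W ?L ?\<rho> - cflip12 (?W ?L ?\<rho>)" .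
  have f23: "cflip23 w p q r \<in> tensor3_space sB G" if "\<And>p q r. w p q r \<in> tensor3_space sB G" for w p q r
    unfolding cflip23_def by (rule flip23_tensor3_space[OF that])
  have "?W ?L ?\<Lambda> - cflip23 (?W ?L ?\<Lambda>) = ?W ?L (?\<Lambda> - cflip23 ?\<Lambda>)"
    unfolding cflip23_bullet3 A2 by (rule W_diff[OF \<Lambda> f23[OF \<Lambda>]])
  also have "\<dots> = ?W ?L ?\<rho> - cflip23 (?W ?L ?\<rho>)"
    unfolding cflip23_bullet3 A2 B1 by (rule W_diff[OF \<rho> f23[OF \<rho>], symmetric])
  finally have Y: "?W ?L ?\<Lambda> - cflip23 (?W ?L ?\<Lambda>) = ?W ?L ?\<rho> - cflip23 (?W ?L ?\<rho>)" .
  show "cright fscale Lg \<delta> (\<delta> (ten a b)) - cflip12 (cright fscale Lg \<delta> (\<delta> (ten a b))) =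
      cleft fscale Lg \<delta> (\<delta> (ten a b))"
    unfolding cobracket_composites(3,4)[OF b defined[OF b]]
    by (rule lie_identity_from_braid[OF X Y])
qed

end

end


section \<open>Laurent polynomials\<close>

lemma lookup_tpow: "Poly_Mapping.lookup (tpow m) n = (if m = n then 1 else 0)"
  by (simp add: tpow_def lookup_single when_def)

text \<open>Only the power of \<open>t\<close> with exponent \<open>p + q + 4\<close> contributes to bidegree \<open>(p, q)\<close>, namely through
  the summand with \<open>i = - p - 3\<close>.\<close>

lemma laurent_comult_component:
  "laurent_comult f p q = fscale (Poly_Mapping.lookup f (p + q + 4) * of_int (- p - 2))
    (tensor lscale UNIV lscale UNIV (tpow (p + 1)) (tpow (q + 1)))"
proof (rule ext)
  fix \<phi> :: "(int \<Rightarrow>\<^sub>0 'a) \<Rightarrow> (int \<Rightarrow>\<^sub>0 'a) \<Rightarrow> 'a"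
  let ?t = "tensor lscale UNIV lscale UNIV (tpow (p + 1)) (tpow (q + 1)) :: ('a, _, _) tens"
  have i: "{i. - i - 2 = p + 1 \<and> j + i = q + 1} = (if j = p + q + 4 then {- p - 3} else {})" for j
    by auto
  have t: "laurent_comult_tpow j p q \<phi> = (if j = p + q + 4 then of_int (- p - 2) * ?t \<phi> else 0)" for j
    unfolding laurent_comult_tpow_def i gspace_laurent by (simp add: fscale_apply algebra_simps)
  have "laurent_comult f p q \<phi> = (\<Sum>j\<in>Poly_Mapping.keys f. Poly_Mapping.lookup f j * laurent_comult_tpow j p q \<phi>)"
    by (simp add: laurent_comult_def sum_fun_apply cscale_def fscale_apply)
  also have "\<dots> = (\<Sum>j\<in>Poly_Mapping.keys f.
      if j = p + q + 4 then Poly_Mapping.lookup f (p + q + 4) * (of_int (- p - 2) * ?t \<phi>) else 0)"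
    unfolding t by (intro sum.cong) auto
  also have "\<dots> = Poly_Mapping.lookup f (p + q + 4) * of_int (- p - 2) * ?t \<phi>"
    by (simp add: in_keys_iff)
  finally show "laurent_comult f p q \<phi> = fscale (Poly_Mapping.lookup f (p + q + 4) * of_int (- p - 2)) ?t \<phi>"
    by (simp only: fscale_apply)
qed

lemma subspace_laurent_UNIV: "module.subspace (lscale :: 'k::field \<Rightarrow> _) UNIV"
proof -
  interpret vector_space "lscale :: 'k \<Rightarrow> _" by (rule vector_space_lscale)
  show ?thesis by (rule subspace_UNIV)
qed

lemma graded_space_laurent: "graded_space (lscale :: 'k::field \<Rightarrow> _) laurent_grading"
proof -
  interpret vector_space "lscale :: 'k \<Rightarrow> _" by (rule vector_space_lscale)
  show ?thesis
    unfolding graded_space_def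
  proof (intro conjI allI impI ballI vector_space_lscale)
    fix i
    show "subspace (laurent_grading i :: (int \<Rightarrow>\<^sub>0 'k) set)"
      by (rule subspaceI)
        (auto simp: laurent_grading_def scale_left_distrib[symmetric] intro: exI[of _ 0])
  next
    fix I :: "int set" and x :: "int \<Rightarrow> (int \<Rightarrow>\<^sub>0 'k)" and i
    assume I: "finite I" "i \<in> I" and x: "\<forall>i\<in>I. x i \<in> laurent_grading i" and 0: "(\<Sum>i\<in>I. x i) = 0"
    have l: "Poly_Mapping.lookup (x j) n = 0" if "j \<in> I" "n \<noteq> j + 1" for j n
      using x that by (force simp: laurent_grading_def lookup_tpow)
    have "0 = (\<Sum>j\<in>I. Poly_Mapping.lookup (x j) (i + 1))"
      by (simp add: lookup_sum[symmetric] 0)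
    also have "\<dots> = (\<Sum>j\<in>I. if j = i then Poly_Mapping.lookup (x i) (i + 1) else 0)"
      by (intro sum.cong) (auto simp: l)
    finally have "Poly_Mapping.lookup (x i) (i + 1) = 0" using I by simp
    then have "Poly_Mapping.lookup (x i) n = 0" for n using l[OF I(2), of n] by (cases "n = i + 1") auto
    then show "x i = 0" by (simp add: poly_mapping_eq_iff fun_eq_iff)
  qed
qed

lemma completed_comultiplication_laurent:
  "completed_comultiplication (lscale :: 'k::field \<Rightarrow> _) laurent_grading laurent_comult"
  unfolding completed_comultiplication_def
proof
  show "lin_on (lscale :: 'k \<Rightarrow> _) (gspace lscale laurent_grading) cscale laurent_comult"
    unfolding lin_on_def
    by (auto simp: fun_eq_iff laurent_comult_component lookup_add cscale_def fscale_apply algebra_simps)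
  have "laurent_comult f p q \<in> tensor_space lscale UNIV lscale UNIV (laurent_grading p) (laurent_grading q)"
    for f :: "int \<Rightarrow>\<^sub>0 'k" and p q
  proof -
    have "lscale 1 (tpow (m + 1)) = (tpow (m + 1) :: int \<Rightarrow>\<^sub>0 'k)" for m
      by (simp add: poly_mapping_eq_iff fun_eq_iff)
    then have "(tpow (m + 1) :: int \<Rightarrow>\<^sub>0 'k) \<in> laurent_grading m" for m
      unfolding laurent_grading_def by (intro CollectI exI[of _ 1]) simp
    then show ?thesis
      unfolding laurent_comult_component
      by (intro fs.subspace_scale[OF subspace_tensor_space] tensor_spaceI)
  qed
  then show "\<forall>f\<in>gspace lscale laurent_grading. laurent_comult (f :: int \<Rightarrow>\<^sub>0 'k) \<in> ctensor_space lscale laurent_grading"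
    by (simp add: ctensor_space_def gspace_laurent)
qed

lemma tensor_map_laurent: "tensor_map (lscale :: 'k::field \<Rightarrow> _) UNIV (\<lambda>f. laurent_comult f p q)"
  unfolding tensor_map_def lin_on_def
proof (intro conjI ballI allI)
  fix f g :: "int \<Rightarrow>\<^sub>0 'k" and c
  show "laurent_comult (f + g) p q = laurent_comult f p q + laurent_comult g p q"
    by (auto simp: fun_eq_iff laurent_comult_component lookup_add fscale_apply algebra_simps)
  show "laurent_comult (lscale c f) p q = fscale c (laurent_comult f p q)"
    by (auto simp: fun_eq_iff laurent_comult_component fscale_apply algebra_simps)
  show "laurent_comult f p q \<in> tensor_space lscale UNIV lscale UNIV UNIV UNIV"
    unfolding laurent_comult_component
    by (intro fs.subspace_scale[OF subspace_tensor_space] tensor_spaceI UNIV_I)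
qed

text \<open>The pure tensor that spans multidegree \<open>(p, q, r)\<close>; note that \<open>t\<^sup>n\<close> has degree \<open>n - 1\<close>.\<close>

abbreviation (input) tpow3 :: "int \<Rightarrow> int \<Rightarrow> int \<Rightarrow> ('k::field, int \<Rightarrow>\<^sub>0 'k) tens3" where
  "tpow3 p q r \<equiv> tensor3 lscale UNIV (tpow (p + 1)) (tpow (q + 1)) (tpow (r + 1))"

lemma laurent_cleft_term:
  "cleft_term lscale laurent_grading laurent_comult (laurent_comult f) p q r i =
    (if i = p + q + 3 then fscale (Poly_Mapping.lookup f (p + q + r + 7) * of_int ((p + 2) * (p + q + 5))) (tpow3 p q r) else 0)"
proof (rule ext)
  fix \<phi> :: "(int \<Rightarrow>\<^sub>0 'a) \<Rightarrow> (int \<Rightarrow>\<^sub>0 'a) \<Rightarrow> (int \<Rightarrow>\<^sub>0 'a) \<Rightarrow> 'a"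
  note pure = map_left_pure(1)[OF tensor_map_laurent UNIV_I UNIV_I vector_space_lscale subspace_laurent_UNIV]
  show "cleft_term lscale laurent_grading laurent_comult (laurent_comult f) p q r i \<phi> =
    (if i = p + q + 3 then fscale (Poly_Mapping.lookup f (p + q + r + 7) * of_int ((p + 2) * (p + q + 5))) (tpow3 p q r) else 0) \<phi>"
  proof (cases "trilin_on lscale UNIV (*) \<phi>")
    case True
    then have b: "bilin_on lscale UNIV lscale UNIV (*) (\<lambda>x y. \<phi> x y z)" for z
      by (auto simp: bilin_on_def trilin_on_def)
    show ?thesis
      unfolding cleft_term_def gspace_laurent laurent_comult_component[of f] map_left_fscale fscale_apply pure
      by (auto simp: True laurent_comult_component fscale_apply tensor_def b tensor3_def lookup_tpow algebra_simps)
  next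
    case False
    then show ?thesis
      by (simp add: cleft_term_def gspace_laurent map_left_def tensor3_def fscale_apply)
  qed
qed

lemma laurent_cright_term:
  "cright_term lscale laurent_grading laurent_comult (laurent_comult f) p q r i =
    (if i = q + r + 3 then fscale (Poly_Mapping.lookup f (p + q + r + 7) * of_int ((p + 2) * (q + 2))) (tpow3 p q r) else 0)"
proof (rule ext)
  fix \<phi> :: "(int \<Rightarrow>\<^sub>0 'a) \<Rightarrow> (int \<Rightarrow>\<^sub>0 'a) \<Rightarrow> (int \<Rightarrow>\<^sub>0 'a) \<Rightarrow> 'a"
  note pure = map_right_pure[OF tensor_map_laurent UNIV_I UNIV_I vector_space_lscale subspace_laurent_UNIV]
  show "cright_term lscale laurent_grading laurent_comult (laurent_comult f) p q r i \<phi> =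
    (if i = q + r + 3 then fscale (Poly_Mapping.lookup f (p + q + r + 7) * of_int ((p + 2) * (q + 2))) (tpow3 p q r) else 0) \<phi>"
  proof (cases "trilin_on lscale UNIV (*) \<phi>")
    case True
    then have b: "bilin_on lscale UNIV lscale UNIV (*) (\<lambda>x y. \<phi> z x y)" for z
      by (auto simp: bilin_on_def trilin_on_def)
    show ?thesis
      unfolding cright_term_def gspace_laurent laurent_comult_component[of f] map_right_fscale fscale_apply pure
      by (auto simp: True laurent_comult_component fscale_apply tensor_def b tensor3_def lookup_tpow algebra_simps)
  next
    case False
    then show ?thesis
      by (simp add: cright_term_def gspace_laurent map_right_def tensor3_def fscale_apply)
  qed
qed

text \<open>In each multidegree, at most one intermediate degree contributes, so both composites are defined.\<close>

lemma laurent_composites: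
  fixes f :: "int \<Rightarrow>\<^sub>0 'k::field"
  shows "cleft_defined lscale laurent_grading laurent_comult (laurent_comult f)"
    and "cright_defined lscale laurent_grading laurent_comult (laurent_comult f)"
    and "cleft lscale laurent_grading laurent_comult (laurent_comult f) = (\<lambda>p q r.
      fscale (Poly_Mapping.lookup f (p + q + r + 7) * of_int ((p + 2) * (p + q + 5))) (tpow3 p q r))"
    and "cright lscale laurent_grading laurent_comult (laurent_comult f) = (\<lambda>p q r.
      fscale (Poly_Mapping.lookup f (p + q + r + 7) * of_int ((p + 2) * (q + 2))) (tpow3 p q r))"
proof -
  have l: "{i. cleft_term lscale laurent_grading laurent_comult (laurent_comult f) p q r i \<noteq> 0} \<subseteq> {p + q + 3}" for p q r
    by (auto simp: laurent_cleft_term)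
  have r: "{i. cright_term lscale laurent_grading laurent_comult (laurent_comult f) p q r i \<noteq> 0} \<subseteq> {q + r + 3}" for p q r
    by (auto simp: laurent_cright_term)
  show "cleft_defined lscale laurent_grading laurent_comult (laurent_comult f)"
    "cright_defined lscale laurent_grading laurent_comult (laurent_comult f)"
    unfolding cleft_defined_def cright_defined_def using finite_subset[OF l] finite_subset[OF r] by blast+
  show "cleft lscale laurent_grading laurent_comult (laurent_comult f) = (\<lambda>p q r.
      fscale (Poly_Mapping.lookup f (p + q + r + 7) * of_int ((p + 2) * (p + q + 5))) (tpow3 p q r))"
    using cleft_eq_sum[OF _ l] by (intro ext) (simp add: laurent_cleft_term)
  show "cright lscale laurent_grading laurent_comult (laurent_comult f) = (\<lambda>p q r.
      fscale (Poly_Mapping.lookup f (p + q + r + 7) * of_int ((p + 2) * (q + 2))) (tpow3 p q r))"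
    using cright_eq_sum[OF _ r] by (intro ext) (simp add: laurent_cright_term)
qed

lemma completed_right_novikov_coalgebra_laurent:
  "completed_right_novikov_coalgebra (lscale :: 'k::field \<Rightarrow> _) laurent_grading laurent_comult"
  unfolding completed_right_novikov_coalgebra_def
proof (intro conjI ballI graded_space_laurent completed_comultiplication_laurent laurent_composites(1,2))
  fix f :: "int \<Rightarrow>\<^sub>0 'k"
  let ?l = "cleft lscale laurent_grading laurent_comult (laurent_comult f)"
  let ?r = "cright lscale laurent_grading laurent_comult (laurent_comult f)"
  show "?l - cflip23 ?l = ?r - cflip23 ?r"
    unfolding laurent_composites(3,4) cflip23_def flip23_fscale flip23_tensor3
    by (intro ext) (simp add: fscale_apply algebra_simps)
  show "?r = cflip12 ?r"
    unfolding laurent_composites(3,4) cflip12_def flip12_fscale flip12_tensor3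
    by (intro ext) (simp add: fscale_apply algebra_simps)
qed

section \<open>Recovering the Novikov axioms\<close>

text \<open>Taking the coefficient of \<open>t\<^sup>m\<close> is linear from \<open>A \<otimes> B\<close> to \<open>A\<close>, so forms on \<open>A\<close> can be pulled back along it.\<close>

lemma ex_laurent_coefficient_map:
  fixes sA :: "'k::field \<Rightarrow> 'a::ab_group_add \<Rightarrow> 'a"
  assumes sA: "vector_space sA"
  obtains g where "lin_on fscale (gspace fscale (tensor_grading sA lscale laurent_grading)) sA g"
    and "\<And>a f. g (tensor sA UNIV lscale (gspace lscale laurent_grading) a f) = sA (Poly_Mapping.lookup f m) a"
proof -
  interpret vector_space sA by fact
  have "bilin_on sA UNIV lscale UNIV sA (\<lambda>a f. sA (Poly_Mapping.lookup f m) a)"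
    by (auto simp: bilin_on_def lin_on_def scale_right_distrib scale_left_distrib lookup_add mult.commute)
  from tensor_universal[OF sA this] show thesis
    unfolding gspace_tensor_grading[OF sA graded_space_laurent] gspace_laurent
    by (auto intro: that simp: gspace_tensor_grading[OF sA graded_space_laurent] gspace_laurent)
qed

text \<open>A form on \<open>A \<otimes> B\<close> that separates the multidegrees: it extracts one coefficient in each factor and
  applies \<open>\<phi>\<close> to the resulting elements of \<open>A\<close>.\<close>

lemma ex_laurent_coefficient_form:
  fixes sA :: "'k::field \<Rightarrow> 'a::ab_group_add \<Rightarrow> 'a"
  assumes sA: "vector_space sA" and \<phi>: "trilin_on sA UNIV (*) \<phi>"
  defines "ten \<equiv> tensor sA UNIV lscale (gspace lscale laurent_grading)"
  obtains \<Phi> where "trilin_on fscale (gspace fscale (tensor_grading sA lscale laurent_grading)) (*) \<Phi>"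
    and "\<And>x y z. \<Phi> (ten x (tpow l)) (ten y (tpow m)) (ten z (tpow n)) = \<phi> x y z"
proof -
  interpret vector_space sA by fact
  let ?L = "gspace fscale (tensor_grading sA lscale laurent_grading)"
  have "\<exists>g. lin_on fscale ?L sA g \<and> (\<forall>a f. g (ten a f) = sA (Poly_Mapping.lookup f m) a)" for m
    unfolding ten_def by (rule ex_laurent_coefficient_map[OF sA, of m]) blast
  then obtain g where g: "\<And>m. lin_on fscale ?L sA (g m)" "\<And>m a f. g m (ten a f) = sA (Poly_Mapping.lookup f m) a"
    by metis
  note D = trilin_onD[OF \<phi> UNIV_I UNIV_I UNIV_I]
  have "trilin_on fscale ?L (*) (\<lambda>x y z. \<phi> (g l x) (g m y) (g n z))"
    using g(1) D unfolding trilin_on_def lin_on_def by auto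
  moreover have "\<phi> (g l (ten x (tpow l))) (g m (ten y (tpow m))) (g n (ten z (tpow n))) = \<phi> x y z" for x y z
    by (simp add: g(2) lookup_tpow)
  ultimately show thesis by (rule that)
qed

text \<open>The component of the Lie identity for \<open>a \<otimes> t\<^sup>n\<close> in multidegree \<open>(p, q, r)\<close>, for the one \<open>n\<close> that
  contributes there, namely \<open>n = p + q + r + 7\<close>. In terms of degrees, permuting the factors permutes
  the arguments of the structure constants \<open>l\<close> and \<open>\<rho>\<close>.\<close>

lemma laurent_lie_identity:
  fixes sA :: "'k::field \<Rightarrow> 'a::ab_group_add \<Rightarrow> 'a"
  assumes sA: "vector_space sA" and \<Delta>A: "comultiplication sA \<Delta>A"
    and \<delta>: "induced_cobracket sA \<Delta>A lscale laurent_grading laurent_comult \<delta>"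
    and lie: "completed_lie_coalgebra fscale (tensor_grading sA lscale laurent_grading) \<delta>"
    and \<phi>: "trilin_on sA UNIV (*) \<phi>"
  fixes a :: 'a and p q r :: int
  defines "L \<equiv> map_left sA UNIV \<Delta>A (\<Delta>A a)" and "R \<equiv> map_right sA UNIV \<Delta>A (\<Delta>A a)"
    and "l \<equiv> \<lambda>p q r. of_int ((p + 2) * (p + q + 5))" and "\<rho> \<equiv> \<lambda>p q r. of_int ((p + 2) * (q + 2))"
  shows "\<rho> p q r * R \<phi> - \<rho> p r q * flip23 R \<phi> - l q r p * flip12 (flip23 L) \<phi> + l r q p * flip23 (flip12 (flip23 L)) \<phi>
    - (\<rho> q p r * flip12 R \<phi> - \<rho> q r p * flip12 (flip23 R) \<phi> - l p r q * flip23 L \<phi> + l r p q * flip12 (flip23 (flip12 (flip23 L))) \<phi>)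
    = l p q r * L \<phi> - l q p r * flip12 L \<phi> - \<rho> r p q * flip23 (flip12 R) \<phi> + \<rho> r q p * flip12 (flip23 (flip12 R)) \<phi>"
proof -
  let ?Lg = "tensor_grading sA lscale laurent_grading"
  let ?G = "gspace lscale laurent_grading :: (int \<Rightarrow>\<^sub>0 'k) set"
  let ?ten = "tensor sA UNIV lscale ?G"
  define b where "b = (tpow (p + q + r + 7) :: int \<Rightarrow>\<^sub>0 'k)"
  have bG: "b \<in> ?G" by (simp add: gspace_laurent)
  have "?ten a b \<in> gspace fscale ?Lg"
    unfolding gspace_tensor_grading[OF sA graded_space_laurent] by (rule tensor_spaceI[OF UNIV_I bG])
  then have eq: "cright fscale ?Lg \<delta> (\<delta> (?ten a b)) - cflip12 (cright fscale ?Lg \<delta> (\<delta> (?ten a b))) =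
      cleft fscale ?Lg \<delta> (\<delta> (?ten a b))"
    using lie unfolding completed_lie_coalgebra_def by blast
  obtain \<Phi> where \<Phi>: "trilin_on fscale (gspace fscale ?Lg) (*) \<Phi>"
    "\<And>x y z. \<Phi> (?ten x (tpow (p + 1))) (?ten y (tpow (q + 1))) (?ten z (tpow (r + 1))) = \<phi> x y z"
    by (rule ex_laurent_coefficient_form[OF sA \<phi>, of "p + 1" "q + 1" "r + 1"]) (rule that)
  have \<Delta>A_map: "tensor_map sA UNIV \<Delta>A" using \<Delta>A by (simp add: comultiplication_def tensor_map_def)
  have UNIV: "module.subspace sA UNIV"
  proof -
    interpret vector_space sA by fact
    show ?thesis by (rule subspace_UNIV)
  qed
  have S: "L \<in> tensor3_space sA UNIV" "R \<in> tensor3_space sA UNIV"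
    unfolding L_def R_def
    by (intro map_left_tensor3_space map_right_tensor3_space \<Delta>A_map tensor_mapD(1)[OF \<Delta>A_map UNIV_I] sA UNIV)+
  have T: "tpow3 p q r \<in> tensor3_space lscale ?G" unfolding gspace_laurent by (intro tensor3_spaceI UNIV_I)
  have eval: "bullet3 sA lscale laurent_grading S (fscale c (tpow3 p q r)) \<Phi> = c * S \<phi>"
    if "S \<in> tensor3_space sA UNIV" for S c
    unfolding bullet3_fscale_right[OF sA graded_space_laurent that T] fscale_apply
    using bullet3_tensor3_apply[OF sA graded_space_laurent \<Phi>(1), unfolded gspace_laurent] \<Phi>(2)[unfolded gspace_laurent]
    by simp
  have lookup: "Poly_Mapping.lookup b (p + q + r + 7) = 1" "Poly_Mapping.lookup b (p + r + q + 7) = 1"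
    "Poly_Mapping.lookup b (q + p + r + 7) = 1" "Poly_Mapping.lookup b (q + r + p + 7) = 1"
    "Poly_Mapping.lookup b (r + p + q + 7) = 1" "Poly_Mapping.lookup b (r + q + p + 7) = 1"
    by (simp_all add: b_def lookup_tpow)
  note comp = cobracket_composites(3,4)[OF sA graded_space_laurent \<Delta>A completed_comultiplication_laurent \<delta> bG
      laurent_composites(1,2), of a, folded L_def R_def, unfolded laurent_composites(3,4)]
  have "(cright fscale ?Lg \<delta> (\<delta> (?ten a b)) - cflip12 (cright fscale ?Lg \<delta> (\<delta> (?ten a b)))) p q r \<Phi> =
      cleft fscale ?Lg \<delta> (\<delta> (?ten a b)) p q r \<Phi>"
    by (simp only: eq)
  then show ?thesis
    unfolding comp
    by (simp only: cflip12_diff cflip12_add cflip12_cflip12)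
      (simp only: cflip12_def cflip23_def minus_apply plus_fun_apply flip12_bullet3 flip23_bullet3
        flip12_fscale flip23_fscale flip12_tensor3 flip23_tensor3 eval S flip12_tensor3_space flip23_tensor3_space
        lookup l_def \<rho>_def mult_1_left)
qed

text \<open>The Lie identity is used in multidegrees \<open>(-1, -2, -2)\<close> and \<open>(-1, -1, -2)\<close>, where most of its
  coefficients vanish. The first of them yields \<open>2 (t L - L) = 0\<close>, which is where the characteristic
  enters.\<close>

lemma novikov_coalgebra_if_laurent_lie:
  fixes sA :: "'k::field_char_0 \<Rightarrow> 'a::ab_group_add \<Rightarrow> 'a"
  assumes sA: "vector_space sA" and \<Delta>A: "comultiplication sA \<Delta>A"
    and \<delta>: "induced_cobracket sA \<Delta>A lscale laurent_grading laurent_comult \<delta>"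
    and lie: "completed_lie_coalgebra fscale (tensor_grading sA lscale laurent_grading) \<delta>"
  shows "novikov_coalgebra sA \<Delta>A"
  unfolding novikov_coalgebra_def
proof (intro conjI allI sA \<Delta>A)
  fix a
  let ?L = "map_left sA UNIV \<Delta>A (\<Delta>A a)" and ?R = "map_right sA UNIV \<Delta>A (\<Delta>A a)"
  note identity = laurent_lie_identity[OF sA \<Delta>A \<delta> lie, where a = a]
  have \<Delta>A_map: "tensor_map sA UNIV \<Delta>A" using \<Delta>A by (simp add: comultiplication_def tensor_map_def)
  have UNIV: "module.subspace sA UNIV"
  proof -
    interpret vector_space sA by fact
    show ?thesis by (rule subspace_UNIV)
  qed
  have S: "?L \<in> tensor3_space sA UNIV" "?R \<in> tensor3_space sA UNIV"
    by (intro map_left_tensor3_space map_right_tensor3_space \<Delta>A_map tensor_mapD(1)[OF \<Delta>A_map UNIV_I] sA UNIV)+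
  have L: "flip23 ?L = ?L"
  proof (rule ext)
    fix \<phi>
    show "flip23 ?L \<phi> = ?L \<phi>"
    proof (cases "trilin_on sA UNIV (*) \<phi>")
      case True
      from identity[OF True, of "- 1" "- 2" "- 2"] show ?thesis by simp
    qed (simp add: tensor3_space_eq_0_outside[OF S(1)] tensor3_space_eq_0_outside[OF flip23_tensor3_space[OF S(1)]])
  qed
  show "?R - flip12 ?R = ?L - flip12 ?L"
  proof (rule ext)
    fix \<phi>
    show "(?R - flip12 ?R) \<phi> = (?L - flip12 ?L) \<phi>"
    proof (cases "trilin_on sA UNIV (*) \<phi>")
      case True
      from identity[OF True, of "- 1" "- 1" "- 2"] show ?thesis by (simp add: L algebra_simps)
    qed (simp add: S[THEN tensor3_space_eq_0_outside] S[THEN flip12_tensor3_space, THEN tensor3_space_eq_0_outside])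
  qed
  show "flip12 (map_right sA UNIV \<Delta>A (flip (\<Delta>A a))) = ?L"
    by (simp only: map_right_flip flip12_flip12 L)
qed

theorem theorem2p14:
  fixes sA :: "'k::field_char_0 \<Rightarrow> 'a::ab_group_add \<Rightarrow> 'a"
    and basisA :: "'a set"
    and \<Delta>A :: "'a \<Rightarrow> ('k, 'a, 'a) tens"
    and sB :: "'k \<Rightarrow> 'b::ab_group_add \<Rightarrow> 'b"
    and B :: "int \<Rightarrow> 'b set"
    and \<Delta>B :: "'b \<Rightarrow> ('k, 'b) ctens"
  assumes "finite_dimensional_vector_space sA basisA"
    and "comultiplication sA \<Delta>A"
    and "graded_space sB B"
    and "completed_comultiplication sB B \<Delta>B"
  shows
    "(novikov_coalgebra sA \<Delta>A \<and> completed_right_novikov_coalgebra sB B \<Delta>B \<longrightarrow>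
        (\<forall>\<delta>. induced_cobracket sA \<Delta>A sB B \<Delta>B \<delta> \<longrightarrow>
           completed_lie_coalgebra fscale (tensor_grading sA sB B) \<delta>)) \<and>
     completed_right_novikov_coalgebra
       (lscale :: 'k \<Rightarrow> _) laurent_grading laurent_comult \<and>
     (\<forall>\<delta>. induced_cobracket sA \<Delta>A lscale laurent_grading laurent_comult \<delta> \<longrightarrow>
        (completed_lie_coalgebra fscale (tensor_grading sA lscale laurent_grading) \<delta> \<longleftrightarrow>
           novikov_coalgebra sA \<Delta>A))"
proof -
  have sA: "vector_space sA"
    using assms(1) by (simp add: finite_dimensional_vector_space_def)
  have lie: "completed_lie_coalgebra fscale (tensor_grading sA lscale laurent_grading) \<delta>"
    if "induced_cobracket sA \<Delta>A lscale laurent_grading laurent_comult \<delta>" "novikov_coalgebra sA \<Delta>A" for \<delta>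
    by (rule completed_lie_coalgebra_cobracket[OF sA graded_space_laurent assms(2) completed_comultiplication_laurent
          that completed_right_novikov_coalgebra_laurent])
  show ?thesis
    using completed_lie_coalgebra_cobracket[OF sA assms(3,2,4)] completed_right_novikov_coalgebra_laurent
      lie novikov_coalgebra_if_laurent_lie[OF sA assms(2)] by blast
qed

end
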